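(* For every positive integer $h$, $$\rho_{\mathrm{inf}}(h)\ \geq\ \frac{1}{(h+1)!},\qquad\text{where}\qquad \rho_{\mathrm{inf}}(h)=\liminf_{n\to\infty}\frac{A(n,2h+1)}{B(n,h)}.$$
   Context: $\mathbb{F}_2$ is the field with two elements. The Hamming distance between $x,y\in\mathbb{F}_2^n$ is the number of coordinates in which they differ. A code is a subset $C\subseteq\mathbb{F}_2^n$ (not necessarily linear); it has minimum distance $\geq d$ if any two distinct elements of $C$ have Hamming distance at least $d$. Define $$A(n,d)=\max\{\#C\mid C\subseteq\mathbb{F}_2^n\text{ is a code with minimum distance}\geq d\}$$ and the sphere packing quantity $$B(n,h)=\frac{2^n}{\binom n0+\binom n1+\cdots+\binom nh}.$$ *)

theory Defs
  imports "HOL-Analysis.Analysis" "HOL-Library.Z2"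
begin

text \<open>Since the length \<open>n\<close> varies inside the statement, vectors in $\mathbb{F}_2^n$ are lists
  of length \<open>n\<close> over the two-element field \<^typ>\<open>bit\<close>.\<close>

definition F2_space :: "nat \<Rightarrow> bit list set" where
  "F2_space n = {x. length x = n}"

text \<open>Only meaningful for lists of equal length.\<close>

definition hamming_dist :: "'a list \<Rightarrow> 'a list \<Rightarrow> nat" where
  "hamming_dist x y = card {i. i < length x \<and> x ! i \<noteq> y ! i}"

definition min_dist_ge :: "nat \<Rightarrow> 'a list set \<Rightarrow> bool" where
  "min_dist_ge d C \<longleftrightarrow> (\<forall>x\<in>C. \<forall>y\<in>C. x \<noteq> y \<longrightarrow> d \<le> hamming_dist x y)"

definition code_A :: "nat \<Rightarrow> nat \<Rightarrow> nat" where
  "code_A n d = Max {card C | C. C \<subseteq> F2_space n \<and> min_dist_ge d C}"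

definition packing_B :: "nat \<Rightarrow> nat \<Rightarrow> real" where
  "packing_B n h = 2 ^ n / (\<Sum>i\<le>h. real (n choose i))"

text \<open>The lower limit is taken in the extended reals, a complete lattice, so that it always exists.\<close>

definition rho_inf :: "nat \<Rightarrow> ereal" where
  "rho_inf h = liminf (\<lambda>n. ereal (real (code_A n (2 * h + 1)) / packing_B n h))"

text \<open>The maximum in \<^const>\<open>code_A\<close> ranges over a finite nonempty set, hence is attained.\<close>

lemma finite_F2_space: "finite (F2_space n)"
proof -
  have "(UNIV :: bit set) \<subseteq> {0, 1}"
  proof
    fix x :: bit
    show "x \<in> {0, 1}" by (cases x) blast+
  qed
  then have "finite (UNIV :: bit set)"
    by (rule finite_subset) blast
  from finite_lists_length_eq[OF this, of n] show ?thesis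
    by (simp add: F2_space_def)
qed

lemma finite_code_sizes: "finite {card C | C. C \<subseteq> F2_space n \<and> min_dist_ge d C}"
  by (rule finite_subset[of _ "card ` Pow (F2_space n)"]) (auto simp: finite_F2_space)

lemma code_A_attained:
  "\<exists>C. C \<subseteq> F2_space n \<and> min_dist_ge d C \<and> card C = code_A n d"
proof -
  have "{} \<subseteq> F2_space n \<and> min_dist_ge d {}" by (simp add: min_dist_ge_def)
  then have "{card C | C. C \<subseteq> F2_space n \<and> min_dist_ge d C} \<noteq> {}" by blast
  from Max_in[OF finite_code_sizes this] show ?thesis
    unfolding code_A_def by auto
qed

lemma code_A_ge:
  assumes "C \<subseteq> F2_space n" and "min_dist_ge d C"
  shows "card C \<le> code_A n d"
  unfolding code_A_def using assms by (intro Max_ge[OF finite_code_sizes]) blast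

end

theory Submission
  imports Defs "HOL-Complex_Analysis.Complex_Analysis" "HOL-Number_Theory.Prime_Powers"
begin

text \<open>
  The codes are punctured unions of Graham--Sloane constant weight codes. Fix a prime $p > n$ and
  attach to $S \subseteq \{0, \dots, n\}$ the polynomial $f_S = \prod_{i \in S} (T - i)$. If
  $S$ and $S'$ have the same size and the $h$ coefficients of $f_S$ and $f_{S'}$ below the leading
  one agree modulo $p$, then factoring out $f_{S \cap S'}$ shows that $S$ and $S'$ differ in at
  least $2h + 2$ places; sets whose sizes are distinct but congruent modulo $2h + 2$ do so trivially.
  There are $(2h + 2) p^h$ possible values of the coefficients and the size, so the pigeonhole
  principle gives a code of length $n + 1$, and after deleting one coordinate
  $A(n, 2h + 1) \geq 2^n / ((h + 1) p^h)$. As $B(n, h) \leq 2^n / \binom{n}{h}$, the bound on the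
  lower limit follows if $p$ can be chosen with $p / n \to 1$.

  The existence of such primes rests on the nonvanishing of $\zeta$ on the line $\Re s = 1$. Given
  this, $\sum (\Lambda(n) - 1) n^{-s}$ extends holomorphically across that line. Integrating
  against the Fejer kernel $k_l$ shows, for fixed $l$, that
  $\sum (\Lambda(n) - 1) n^{-1-\delta} k_l(\log n - y) \to 0$ as $y \to \infty$, uniformly in
  $\delta$ (Wiener--Ikehara). The part of this sum coming from $1$ stays above an
  absolute constant. If there were no primes with $|\log p - y| \leq \eta$, the part coming from
  $\Lambda$ would be $O(1 / (l \eta^2)) + o(1)$ because $k_l(u) = O(1 / (l u^2))$, which is
  impossible for large $l$.
\<close>

section \<open>Unions of Graham--Sloane codes\<close>

text \<open>The coefficients are integers and are compared modulo \<open>p\<close> only where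
  needed, since the prime varies with the length of the code.\<close>

definition locator_poly :: "nat set \<Rightarrow> int poly" where
  "locator_poly S = (\<Prod>i\<in>S. [:- int i, 1:])"

lemma degree_locator_poly: "degree (locator_poly S) = card S"
  unfolding locator_poly_def by (subst degree_prod_eq_sum_degree) auto

lemma lead_coeff_locator_poly: "coeff (locator_poly S) (card S) = 1"
  using lead_coeff_prod[of "\<lambda>i. [:- int i, 1:]" S]
  by (simp add: locator_poly_def flip: degree_locator_poly)

lemma poly_locator_poly: "poly (locator_poly S) x = (\<Prod>i\<in>S. x - int i)"
  by (simp add: locator_poly_def poly_prod)

lemma locator_poly_Un:
  "finite S \<Longrightarrow> finite T \<Longrightarrow> S \<inter> T = {} \<Longrightarrow> locator_poly (S \<union> T) = locator_poly S * locator_poly T"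
  unfolding locator_poly_def by (rule prod.union_disjoint)

text \<open>Evaluate at some \<open>x\<close> in \<open>A\<close>. The first polynomial vanishes
  there, and the second is a product of differences \<open>x - i\<close> with
  \<open>0 < |x - i| < p\<close>, which a prime \<open>p\<close> cannot divide.\<close>

lemma locator_poly_diff_nonzero_mod:
  assumes p: "prime p" and A: "A \<subseteq> {..<p}" "A \<noteq> {}" and B: "B \<subseteq> {..<p}" and AB: "A \<inter> B = {}"
  shows "\<exists>j. \<not> int p dvd coeff (locator_poly A - locator_poly B) j"
proof (rule ccontr)
  assume "\<not> ?thesis"
  then have all: "int p dvd coeff (locator_poly A - locator_poly B) j" for j by blast
  have fin: "finite A" "finite B" using A(1) B finite_subset by blast+
  obtain x where x: "x \<in> A" using A(2) by blast
  have "int p dvd poly (locator_poly A - locator_poly B) (int x)"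
    unfolding poly_altdef by (intro dvd_sum dvd_mult2 all)
  moreover have "poly (locator_poly A) (int x) = 0"
    using x fin by (auto simp: poly_locator_poly)
  ultimately have "int p dvd (\<Prod>i\<in>B. int x - int i)" by (simp add: poly_locator_poly)
  moreover have "prime (int p)" using p by simp
  ultimately obtain i where i: "i \<in> B" "int p dvd int x - int i"
    using fin(2) by (auto simp: prime_dvd_prod_iff)
  have "x < p" "i < p" "x \<noteq> i" using x i(1) A(1) B AB by auto
  then have "\<bar>int x - int i\<bar> < int p" "int x - int i \<noteq> 0" by auto
  with i(2) show False using zdvd_not_zless[of "\<bar>int x - int i\<bar>" "int p"] by auto
qed

text \<open>Factoring out the common roots gives
  \<open>locator_poly S - locator_poly T = locator_poly C * g\<close> with a monic first factor.
  Modulo \<open>p\<close>, \<open>g\<close> is nonzero and of degree \<open>j < card A\<close>,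
  because the leading terms of its two parts cancel. So the difference has a nonzero coefficient at
  \<open>card C + j\<close>, which is \<open>card A - j\<close> places below the top. If
  \<open>card A <= h\<close>, that place is among those assumed to agree.\<close>

lemma locator_poly_top_coeffs:
  assumes p: "prime p" and S: "S \<subseteq> {..<p}" and T: "T \<subseteq> {..<p}" and ne: "S \<noteq> T"
    and card: "card S = card T"
    and eq: "\<And>i. 1 \<le> i \<Longrightarrow> i \<le> h \<Longrightarrow> coeff (locator_poly S) (card S - i) mod int p = coeff (locator_poly T) (card T - i) mod int p"
  shows "card (S - T) > h"
proof (rule ccontr)
  assume "\<not> ?thesis"
  then have ah: "card (S - T) \<le> h" by simp
  define A where "A = S - T"
  define B where "B = T - S"
  define C where "C = S \<inter> T"
  define g where "g = locator_poly A - locator_poly B"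
  have fin: "finite S" "finite T" using S T finite_subset by blast+
  have SA: "S = C \<union> A" and TB: "T = C \<union> B" by (auto simp: A_def B_def C_def)
  have cS: "card S = card C + card A" unfolding SA using fin by (intro card_Un_disjoint) (auto simp: A_def C_def)
  have cT: "card T = card C + card B" unfolding TB using fin by (intro card_Un_disjoint) (auto simp: B_def C_def)
  have cAB: "card B = card A" using cS cT card by simp
  have "A \<noteq> {}"
  proof
    assume "A = {}"
    then have "S \<subseteq> T" by (auto simp: A_def)
    then show False using card_subset_eq[OF fin(2)] card ne by blast
  qed
  then have "\<exists>j. \<not> int p dvd coeff g j"
    unfolding g_def by (intro locator_poly_diff_nonzero_mod[OF p]) (use S T in \<open>auto simp: A_def B_def\<close>)
  define J where "J = {j. \<not> int p dvd coeff g j}"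
  have J: "J \<noteq> {}" using \<open>\<exists>j. _\<close> by (auto simp: J_def)
  have Jlt: "j < card A" if "j \<in> J" for j
  proof (rule ccontr)
    assume "\<not> j < card A"
    then consider "j = card A" | "j > card A" by linarith
    then have "coeff g j = 0"
    proof cases
      case 1
      then show ?thesis using lead_coeff_locator_poly[of A] lead_coeff_locator_poly[of B] cAB by (simp add: g_def)
    next
      case 2
      then show ?thesis using cAB by (simp add: g_def coeff_eq_0 degree_locator_poly)
    qed
    then show False using that by (simp add: J_def)
  qed
  have fJ: "finite J" by (rule finite_subset[of _ "{..<card A}"]) (use Jlt in auto)
  define j where "j = Max J"
  have jJ: "j \<in> J" unfolding j_def using fJ J by (rule Max_in)
  have jmax: "int p dvd coeff g k" if "k > j" for k
    using Max_ge[OF fJ, of k] that unfolding j_def[symmetric] by (auto simp: J_def)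
  have diff: "locator_poly S - locator_poly T = locator_poly C * g"
  proof -
    have "locator_poly S = locator_poly C * locator_poly A" unfolding SA using fin by (intro locator_poly_Un) (auto simp: A_def C_def)
    moreover have "locator_poly T = locator_poly C * locator_poly B" unfolding TB using fin by (intro locator_poly_Un) (auto simp: B_def C_def)
    ultimately show ?thesis by (simp add: g_def algebra_simps)
  qed
  define N where "N = card C + j"
  have "coeff (locator_poly C * g) N = (\<Sum>i\<le>N. coeff (locator_poly C) i * coeff g (N - i))"
    by (rule coeff_mult)
  also have "\<dots> = coeff (locator_poly C) (card C) * coeff g (N - card C) + (\<Sum>i\<in>{..N} - {card C}. coeff (locator_poly C) i * coeff g (N - i))"
    by (rule sum.remove) (auto simp: N_def)
  finally have cN: "coeff (locator_poly C * g) N = coeff g j + (\<Sum>i\<in>{..N} - {card C}. coeff (locator_poly C) i * coeff g (N - i))"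
    by (simp add: lead_coeff_locator_poly N_def)
  \<comment> \<open>Below \<open>card C\<close> the other factor is a coefficient of
    \<open>g\<close> beyond \<open>j\<close>, divisible by \<open>p\<close>; above
    \<open>card C\<close> the coefficient of \<open>locator_poly C\<close> is zero.\<close>
  have "int p dvd (\<Sum>i\<in>{..N} - {card C}. coeff (locator_poly C) i * coeff g (N - i))"
  proof (rule dvd_sum)
    fix i assume i: "i \<in> {..N} - {card C}"
    show "int p dvd coeff (locator_poly C) i * coeff g (N - i)"
    proof (cases "i < card C")
      case True
      then have "N - i > j" using i by (auto simp: N_def)
      then show ?thesis using jmax by (intro dvd_mult)
    next
      case False
      then have "i > card C" using i by auto
      then show ?thesis by (simp add: coeff_eq_0 degree_locator_poly)
    qed
  qed
  then have nd: "\<not> int p dvd coeff (locator_poly C * g) N"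
    using jJ unfolding cN J_def by (simp add: dvd_add_left_iff)
  define i where "i = card A - j"
  have i: "1 \<le> i" "i \<le> h" "card S - i = N" "card T - i = N"
    using Jlt[OF jJ] ah cS cT cAB by (auto simp: i_def N_def A_def)
  have "coeff (locator_poly S) N mod int p = coeff (locator_poly T) N mod int p"
    using eq[OF i(1,2)] by (simp only: i(3,4))
  then have "int p dvd coeff (locator_poly S) N - coeff (locator_poly T) N" by (rule mod_eq_dvd_iff[THEN iffD1])
  then have "int p dvd coeff (locator_poly C * g) N" by (simp flip: diff)
  with nd show False by contradiction
qed

text \<open>Pigeonhole principle in multiplied form: were every fibre too small, summing over
  \<open>B\<close> would give \<open>card B * card A < card B * card A\<close>.\<close>

lemma large_fibre:
  assumes "finite A" "finite B" "f ` A \<subseteq> B" "A \<noteq> {}"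
  obtains y where "card A \<le> card B * card {x \<in> A. f x = y}"
proof -
  have B: "B \<noteq> {}" using assms by blast
  have "\<exists>y\<in>B. card A \<le> card B * card {x \<in> A. f x = y}"
  proof (rule ccontr)
    assume "\<not> ?thesis"
    then have lt: "card B * card {x \<in> A. f x = y} < card A" if "y \<in> B" for y using that by (auto simp: not_le)
    have "card A = (\<Sum>y\<in>B. card {x \<in> A. f x = y})"
      using sum.group[OF assms(1-3), of "\<lambda>_. 1::nat"] by simp
    then have "card B * card A = (\<Sum>y\<in>B. card B * card {x \<in> A. f x = y})" by (simp add: sum_distrib_left)
    also have "\<dots> < (\<Sum>y\<in>B. card A)" using assms(2) B lt by (intro sum_strict_mono) auto
    finally show False by simp
  qed
  then show ?thesis using that by blast
qed

lemma graham_sloane_family: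
  assumes p: "prime p" and m: "m \<le> p"
  obtains F where "F \<subseteq> Pow {..<m}" "2 ^ m \<le> (2 * h + 2) * p ^ h * card F"
    "\<And>S T. S \<in> F \<Longrightarrow> T \<in> F \<Longrightarrow> S \<noteq> T \<Longrightarrow> 2 * h + 2 \<le> card ((S - T) \<union> (T - S))"
proof -
  define lab where "lab S = (card S mod (2 * h + 2), \<lambda>i\<in>{1..h}. coeff (locator_poly S) (card S - i) mod int p)" for S
  define B where "B = {..<2 * h + 2} \<times> ({1..h} \<rightarrow>\<^sub>E {0..<int p})"
  have p0: "p > 0" using p by (simp add: prime_gt_0_nat)
  have B: "finite B" "card B = (2 * h + 2) * p ^ h"
    by (auto simp: B_def card_cartesian_product card_PiE intro!: finite_PiE)
  have "lab ` Pow {..<m} \<subseteq> B" using p0 by (auto simp: lab_def B_def)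
  then obtain y where y: "card (Pow {..<m}) \<le> card B * card {S \<in> Pow {..<m}. lab S = y}"
    using large_fibre[of "Pow {..<m}" B lab] B(1) by blast
  define F where "F = {S \<in> Pow {..<m}. lab S = y}"
  show ?thesis
  proof (rule that[of F])
    show "F \<subseteq> Pow {..<m}" by (auto simp: F_def)
    show "2 ^ m \<le> (2 * h + 2) * p ^ h * card F" using y by (simp add: F_def B(2) card_Pow)
    fix S T assume ST: "S \<in> F" "T \<in> F" "S \<noteq> T"
    have sub: "S \<subseteq> {..<p}" "T \<subseteq> {..<p}" using ST m by (auto simp: F_def)
    have fin: "finite S" "finite T" using sub finite_subset by blast+
    have lab: "lab S = lab T" using ST by (simp add: F_def)
    then have md: "card S mod (2 * h + 2) = card T mod (2 * h + 2)" by (simp add: lab_def)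
    have cu: "card ((S - T) \<union> (T - S)) = card (S - T) + card (T - S)"
      using fin by (intro card_Un_disjoint) auto
    have S: "card S = card (S \<inter> T) + card (S - T)" using fin by (metis card_Int_Diff)
    have T: "card T = card (S \<inter> T) + card (T - S)" using fin by (metis card_Int_Diff Int_commute)
    show "2 * h + 2 \<le> card ((S - T) \<union> (T - S))"
    proof (cases "card S = card T")
      \<comment> \<open>Sets of equal size have differences of equal size, so \<open>h + 1\<close>
        elements on each side give \<open>2 * h + 2\<close>.\<close>
      case True
      have "coeff (locator_poly S) (card S - i) mod int p = coeff (locator_poly T) (card T - i) mod int p"
        if "1 \<le> i" "i \<le> h" for i
        using lab that by (auto simp: lab_def restrict_def fun_eq_iff split: if_splits)
      then have "card (S - T) > h" by (intro locator_poly_top_coeffs[OF p sub ST(3) True])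
      then show ?thesis using cu S T True by simp
    next
      case False
      show ?thesis
      proof (cases "card S < card T")
        case True
        then have "(2 * h + 2) dvd (card T - card S)" using md by (metis mod_eq_dvd_iff_nat less_imp_le)
        then have "2 * h + 2 \<le> card T - card S" using True by (intro dvd_imp_le) auto
        then show ?thesis using cu S T by simp
      next
        case f: False
        then have "(2 * h + 2) dvd (card S - card T)" using md by (metis mod_eq_dvd_iff_nat not_less)
        then have "2 * h + 2 \<le> card S - card T" using False f by (intro dvd_imp_le) auto
        then show ?thesis using cu S T by simp
      qed
    qed
  qed
qed

text \<open>Elements of \<open>S\<close> that are at least \<open>n\<close> are ignored. Applied to
  subsets of \<open>{..<Suc n}\<close>, this is the puncturing at the last coordinate.\<close>

definition set_word :: "nat \<Rightarrow> nat set \<Rightarrow> bit list" where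
  "set_word n S = map (\<lambda>i. of_bool (i \<in> S)) [0..<n]"

lemma hamming_dist_set_word: "hamming_dist (set_word n S) (set_word n T) = card (((S - T) \<union> (T - S)) \<inter> {..<n})"
  unfolding hamming_dist_def by (rule arg_cong[where f = card]) (auto simp: set_word_def of_bool_def split: if_splits)

text \<open>The family lives in length \<open>n + 1 <= p\<close>. Puncturing costs one unit of
  distance, from \<open>2 * h + 2\<close> to \<open>2 * h + 1\<close>, and it keeps the words
  distinct. The extra factor 2 on the left offsets the 2 in \<open>2 * h + 2\<close>.\<close>

theorem code_A_lower_bound:
  assumes p: "prime p" and n: "n < p"
  shows "2 ^ (n + 1) \<le> (2 * h + 2) * p ^ h * code_A n (2 * h + 1)"
proof -
  obtain F where F: "F \<subseteq> Pow {..<Suc n}" "2 ^ Suc n \<le> (2 * h + 2) * p ^ h * card F"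
    "\<And>S T. S \<in> F \<Longrightarrow> T \<in> F \<Longrightarrow> S \<noteq> T \<Longrightarrow> 2 * h + 2 \<le> card ((S - T) \<union> (T - S))"
    using graham_sloane_family[OF p, of "Suc n" h] n by (metis Suc_leI)
  have d: "2 * h + 1 \<le> hamming_dist (set_word n S) (set_word n T)" if "S \<in> F" "T \<in> F" "S \<noteq> T" for S T
  proof -
    let ?D = "(S - T) \<union> (T - S)"
    have "S \<subseteq> {..<Suc n}" "T \<subseteq> {..<Suc n}" using F(1) that by auto
    then have "?D \<subseteq> insert n (?D \<inter> {..<n})" unfolding lessThan_Suc by blast
    then have "card ?D \<le> card (insert n (?D \<inter> {..<n}))" by (intro card_mono) auto
    also have "\<dots> \<le> Suc (card (?D \<inter> {..<n}))" by (rule card_insert_le_m1) auto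
    finally show ?thesis using F(3)[OF that] by (simp add: hamming_dist_set_word)
  qed
  have inj: "inj_on (set_word n) F"
  proof (rule inj_onI, rule ccontr)
    fix S T assume "S \<in> F" "T \<in> F" "set_word n S = set_word n T" "S \<noteq> T"
    with d[of S T] show False by (simp add: hamming_dist_def)
  qed
  have "card (set_word n ` F) \<le> code_A n (2 * h + 1)"
    by (rule code_A_ge) (use d in \<open>auto simp: F2_space_def set_word_def min_dist_ge_def\<close>)
  then have "card F \<le> code_A n (2 * h + 1)" by (simp add: card_image[OF inj])
  then have "(2 * h + 2) * p ^ h * card F \<le> (2 * h + 2) * p ^ h * code_A n (2 * h + 1)" by (rule mult_left_mono) simp
  with F(2) have "2 ^ Suc n \<le> (2 * h + 2) * p ^ h * code_A n (2 * h + 1)" by (rule order_trans)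
  then show ?thesis by (simp only: Suc_eq_plus1)
qed

section \<open>The zeta function on the line of real part one\<close>

text \<open>\<open>zeta_reg s\<close> is $(s - 1) \zeta(s)$ for $\Re s > 1$: adding the telescoping difference
  $(n + 1)^{1 - s} - n^{1 - s}$ to $(s - 1) n^{-s}$ makes the series converge for $\Re s > 0$.
  Since \<open>0 powr s = 0\<close>, the index $0$ contributes nothing to the Dirichlet series below.\<close>

definition zeta_term :: "nat \<Rightarrow> complex \<Rightarrow> complex" where
  "zeta_term n s = (s - 1) * of_nat n powr (- s) - of_nat n powr (1 - s) + of_nat (Suc n) powr (1 - s)"

definition zeta_series :: "complex \<Rightarrow> complex" where
  "zeta_series s = (\<Sum>n. of_nat n powr (- s))"

definition zeta_reg :: "complex \<Rightarrow> complex" where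
  "zeta_reg s = 1 + (\<Sum>n. zeta_term (Suc n) s)"

text \<open>Mean value estimate: on the segment from \<open>n\<close> to \<open>n + 1\<close> the
  derivative of \<open>z powr (- s)\<close> is largest in norm at the left end.\<close>

lemma norm_powr_diff_le:
  fixes s :: complex and x :: real
  assumes n: "n > 0" and s: "Re s > 0" and x: "real n \<le> x" "x \<le> real n + 1"
  shows "norm (of_nat n powr (- s) - of_real x powr (- s)) \<le> norm s * real n powr (- Re s - 1)"
proof -
  let ?S = "closed_segment (of_real (real n)) (of_real (real n + 1)) :: complex set"
  have S: "\<exists>t. z = of_real t \<and> real n \<le> t \<and> t \<le> real n + 1" if "z \<in> ?S" for z
  proof -
    have "z \<in> of_real ` closed_segment (real n) (real n + 1)"
      using that by (simp only: closed_segment_of_real)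
    then show ?thesis by (auto simp: closed_segment_eq_real_ivl split: if_splits)
  qed
  have "norm ((\<lambda>z. z powr (- s)) (of_real (real n)) - (\<lambda>z. z powr (- s)) (of_real x))
      \<le> (norm s * real n powr (- Re s - 1)) * norm (of_real (real n) - of_real x :: complex)"
  proof (rule field_differentiable_bound[where S = ?S])
    fix z assume "z \<in> ?S"
    then obtain t where t: "z = of_real t" "real n \<le> t" "t \<le> real n + 1" using S by blast
    then show "((\<lambda>z. z powr - s) has_field_derivative ((- s) * z powr (- s - 1))) (at z within ?S)"
      using n by (intro has_field_derivative_at_within[OF has_field_derivative_powr]) (auto simp: complex_nonpos_Reals_iff)
    have "norm (z powr (- s - 1)) = t powr (- Re s - 1)"
      using t n by (subst norm_powr_real_powr) auto
    also have "\<dots> \<le> real n powr (- Re s - 1)"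
      using t n s by (intro powr_mono2') auto
    finally show "norm ((- s) * z powr (- s - 1)) \<le> norm s * real n powr (- Re s - 1)"
      by (simp add: norm_mult mult_left_mono)
  next
    have "of_real x \<in> (of_real ` closed_segment (real n) (real n + 1) :: complex set)"
      using x by (auto simp: closed_segment_eq_real_ivl)
    then show "of_real x \<in> ?S" by (simp only: closed_segment_of_real)
  qed auto
  also have "\<dots> \<le> (norm s * real n powr (- Re s - 1)) * 1"
  proof (rule mult_left_mono)
    have "norm (of_real (real n) - of_real x :: complex) = \<bar>real n - x\<bar>"
      by (metis norm_of_real of_real_diff)
    then show "norm (of_real (real n) - of_real x :: complex) \<le> 1" using x by auto
  qed auto
  finally show ?thesis by simp
qed

text \<open>\<open>zeta_term n s\<close> is the increment over the segment from \<open>n\<close> to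
  \<open>n + 1\<close> of a function with derivative
  \<open>(s - 1) * (n powr (- s) - z powr (- s))\<close>. This derivative is already small by
  \<open>norm_powr_diff_le\<close>, which gains the extra power of \<open>n\<close>.\<close>

lemma norm_zeta_term_le:
  assumes n: "n > 0" and s: "Re s > 0"
  shows "norm (zeta_term n s) \<le> norm s * norm (s - 1) * real n powr (- Re s - 1)"
proof -
  let ?S = "closed_segment (of_real (real n)) (of_real (real n + 1)) :: complex set"
  let ?f = "\<lambda>z. (s - 1) * z * of_nat n powr (- s) + z powr (1 - s)"
  let ?B = "norm s * norm (s - 1) * real n powr (- Re s - 1)"
  have S: "\<exists>t. z = of_real t \<and> real n \<le> t \<and> t \<le> real n + 1" if "z \<in> ?S" for z
  proof -
    have "z \<in> of_real ` closed_segment (real n) (real n + 1)"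
      using that by (simp only: closed_segment_of_real)
    then show ?thesis by (auto simp: closed_segment_eq_real_ivl split: if_splits)
  qed
  have "norm (?f (of_real (real n + 1)) - ?f (of_real (real n)))
      \<le> ?B * norm (of_real (real n + 1) - of_real (real n) :: complex)"
  proof (rule field_differentiable_bound[where S = ?S])
    fix z assume "z \<in> ?S"
    then obtain t where t: "z = of_real t" "real n \<le> t" "t \<le> real n + 1" using S by blast
    then have z: "z \<notin> \<real>\<^sub>\<le>\<^sub>0" using n by (auto simp: complex_nonpos_Reals_iff)
    show "(?f has_field_derivative ((s - 1) * (of_nat n powr (- s) - z powr (- s)))) (at z within ?S)"
      by (rule has_field_derivative_at_within)
        (use z in \<open>auto intro!: derivative_eq_intros has_field_derivative_powr simp: algebra_simps\<close>)
    have "norm (of_nat n powr (- s) - z powr (- s)) \<le> norm s * real n powr (- Re s - 1)"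
      unfolding t by (rule norm_powr_diff_le) (use n s t in auto)
    then have "norm (s - 1) * norm (of_nat n powr (- s) - z powr (- s)) \<le> norm (s - 1) * (norm s * real n powr (- Re s - 1))"
      by (rule mult_left_mono) auto
    then show "norm ((s - 1) * (of_nat n powr (- s) - z powr (- s))) \<le> ?B"
      by (simp add: norm_mult mult_ac)
  qed auto
  also have "of_real (real n + 1) - of_real (real n) = (1::complex)" by simp
  also have "?f (of_real (real n + 1)) - ?f (of_real (real n)) = zeta_term n s"
    by (simp add: zeta_term_def algebra_simps)
  finally show ?thesis by simp
qed

text \<open>On the ball of radius \<open>Re s / 2\<close> around \<open>s\<close> the real part
  stays at least \<open>Re s / 2\<close>, so \<open>norm_zeta_term_le\<close> gives a summable
  majorant there and the series may be differentiated termwise.\<close>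

lemma zeta_reg_aux:
  "\<exists>g g'. \<forall>s\<in>{s. Re s > 0}. ((\<lambda>n. zeta_term (Suc n) s) sums g s) \<and>
      ((\<lambda>n. deriv (zeta_term (Suc n)) s) sums g' s) \<and> (g has_field_derivative g' s) (at s)"
proof (rule series_and_derivative_comparison_local)
  show "open {s. Re s > 0}" by (rule open_halfspace_Re_gt)
  show "(zeta_term (Suc n) has_field_derivative deriv (zeta_term (Suc n)) s) (at s)" for n s
  proof -
    have p: "(\<lambda>s. of_nat (Suc m) powr f s) field_differentiable at s"
      if "f field_differentiable at s" for f :: "complex \<Rightarrow> complex" and m
      using field_differentiable_compose[OF that field_differentiable_powr_right[of "of_nat (Suc m)"]]
      by (simp add: o_def del: of_nat_Suc)
    have "(\<lambda>s. zeta_term (Suc n) s) field_differentiable at s"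
      unfolding zeta_term_def by (intro derivative_intros p)
    then show ?thesis using DERIV_deriv_iff_field_differentiable by blast
  qed
  show "\<exists>d h. 0 < d \<and> summable h \<and> (\<forall>\<^sub>F n in sequentially. \<forall>t\<in>ball s d \<inter> {s. Re s > 0}. norm (zeta_term (Suc n) t) \<le> h n)"
    if "s \<in> {s. Re s > 0}" for s
  proof -
    define d where "d = Re s / 2"
    have d: "d > 0" using that by (simp add: d_def)
    define C where "C = (norm s + d) * (norm (s - 1) + d)"
    define h where "h n = C * real (Suc n) powr (- d - 1)" for n
    have "summable (\<lambda>n. real n powr (- d - 1))"
      using d by (simp add: summable_real_powr_iff)
    then have "summable (\<lambda>n. real (Suc n) powr (- d - 1))" by (rule summable_Suc_iff[THEN iffD2])
    then have h: "summable h" unfolding h_def by (rule summable_mult)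
    have "norm (zeta_term (Suc n) t) \<le> h n" if "t \<in> ball s d" for n t
    proof -
      have st: "norm (s - t) < d" using that by (simp add: dist_norm)
      have Re: "d \<le> Re t" using st complex_Re_le_cmod[of "s - t"] by (simp add: d_def)
      have 1: "norm t \<le> norm s + d"
        using st norm_triangle_sub[of t s] by (simp add: norm_minus_commute)
      have 2: "norm (t - 1) \<le> norm (s - 1) + d"
        using st norm_triangle_sub[of "t-1" "s-1"] by (simp add: norm_minus_commute)
      have "norm (zeta_term (Suc n) t) \<le> norm t * norm (t - 1) * real (Suc n) powr (- Re t - 1)"
        using Re d by (intro norm_zeta_term_le) auto
      also have "\<dots> \<le> h n" unfolding h_def C_def
        using 1 2 Re d by (intro mult_mono powr_mono) auto
      finally show ?thesis .
    qed
    then show ?thesis using d h by (intro exI[of _ d] exI[of _ h]) auto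
  qed
qed

lemma zeta_term_sums: "Re s > 0 \<Longrightarrow> (\<lambda>n. zeta_term (Suc n) s) sums (zeta_reg s - 1)"
  using zeta_reg_aux by (auto simp: zeta_reg_def sums_iff)

lemma zeta_reg_holomorphic: "zeta_reg holomorphic_on {s. Re s > 0}"
proof -
  obtain g where g: "\<And>s. Re s > 0 \<Longrightarrow> (\<lambda>n. zeta_term (Suc n) s) sums g s \<and> g field_differentiable (at s)"
    using zeta_reg_aux unfolding field_differentiable_def by blast
  have "(\<lambda>s. 1 + g s) holomorphic_on {s. Re s > 0}"
    unfolding holomorphic_on_def
  proof
    fix s assume "s \<in> {s. 0 < Re s}"
    then have "g field_differentiable (at s)" using g by auto
    then show "(\<lambda>s. 1 + g s) field_differentiable at s within {s. 0 < Re s}"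
      by (intro field_differentiable_add field_differentiable_const)
        (rule field_differentiable_at_within)
  qed
  then show ?thesis
    by (rule holomorphic_transform) (use g in \<open>auto simp: zeta_reg_def sums_iff\<close>)
qed

text \<open>This says that the pole of zeta at 1 has residue 1.\<close>

lemma zeta_reg_1: "zeta_reg 1 = 1"
proof -
  have "zeta_term (Suc n) 1 = 0" for n
    by (simp add: zeta_term_def del: of_nat_Suc)
  then show ?thesis by (simp add: zeta_reg_def)
qed

lemma summable_zeta_series: "Re s > 1 \<Longrightarrow> summable (\<lambda>n. norm (of_nat n powr (- s) :: complex))"
  by (simp add: norm_powr_real_powr summable_real_powr_iff)

text \<open>For \<open>Re s > 1\<close> the telescoping part converges by itself, with sum -1; the
  constant 1 in \<open>zeta_reg\<close> compensates for it.\<close>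

lemma zeta_reg_eq:
  assumes s: "Re s > 1"
  shows "zeta_reg s = (s - 1) * zeta_series s"
proof -
  have "summable (\<lambda>n. of_nat n powr (- s) :: complex)"
    using summable_zeta_series[OF s] by (rule summable_norm_cancel)
  then have "(\<lambda>n. of_nat n powr (- s) :: complex) sums zeta_series s"
    unfolding zeta_series_def by (rule summable_sums)
  then have 1: "(\<lambda>n. of_nat (Suc n) powr (- s) :: complex) sums zeta_series s"
    by (subst sums_Suc_iff) auto
  have "(\<lambda>n. norm (of_nat (Suc n) powr (1 - s) :: complex)) \<longlonglongrightarrow> 0"
  proof -
    have "(\<lambda>n. real (Suc n) powr (1 - Re s)) \<longlonglongrightarrow> 0"
      using s by (intro tendsto_neg_powr filterlim_compose[OF filterlim_real_sequentially] filterlim_Suc) auto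
    then show ?thesis by (subst norm_powr_real_powr) (auto simp del: of_nat_Suc)
  qed
  then have "(\<lambda>n. of_nat (Suc n) powr (1 - s) :: complex) \<longlonglongrightarrow> 0"
    using tendsto_norm_zero_iff by blast
  from telescope_sums[OF this]
  have 2: "(\<lambda>n. of_nat (Suc (Suc n)) powr (1 - s) - of_nat (Suc n) powr (1 - s) :: complex) sums (-1)"
    by simp
  have "(\<lambda>n. zeta_term (Suc n) s) sums ((s - 1) * zeta_series s + (- 1))"
    using sums_add[OF sums_mult[OF 1, of "s - 1"] 2] by (simp add: zeta_term_def algebra_simps)
  moreover have "(\<lambda>n. zeta_term (Suc n) s) sums (zeta_reg s - 1)"
    using s by (intro zeta_term_sums) auto
  ultimately have "zeta_reg s - 1 = (s - 1) * zeta_series s + (- 1)"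
    by (rule sums_unique2[symmetric])
  then show ?thesis by (simp add: algebra_simps)
qed

section \<open>The Dirichlet series of the von Mangoldt function\<close>

definition mangoldt_series :: "complex \<Rightarrow> complex" where
  "mangoldt_series s = (\<Sum>n. mangoldt n * of_nat n powr (- s))"

text \<open>The logarithm is absorbed by half of the excess of \<open>\<sigma>\<close> over
  1.\<close>

lemma summable_ln_powr:
  assumes "\<sigma> > 1"
  shows "summable (\<lambda>n. ln (real n) * real n powr (- \<sigma>))"
proof -
  define a where "a = (\<sigma> - 1) / 2"
  have a: "a > 0" "a - \<sigma> < -1" using assms by (auto simp: a_def field_simps)
  show ?thesis
  proof (rule summable_comparison_test')
    show "summable (\<lambda>n. real n powr (a - \<sigma>) / a)"
      using a by (intro summable_divide) (simp add: summable_real_powr_iff)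
    fix n :: nat assume n: "n \<ge> 1"
    have "ln (real n) \<le> real n powr a / a" using n a by (intro ln_powr_bound) auto
    then have "ln (real n) * real n powr (- \<sigma>) \<le> (real n powr a / a) * real n powr (- \<sigma>)"
      by (rule mult_right_mono) auto
    also have "\<dots> = real n powr (a - \<sigma>) / a" by (simp add: powr_diff powr_minus field_simps)
    finally show "norm (ln (real n) * real n powr (- \<sigma>)) \<le> real n powr (a - \<sigma>) / a"
      using n by auto
  qed
qed

lemma summable_mangoldt_powr:
  assumes "\<sigma> > 1"
  shows "summable (\<lambda>n. mangoldt n * real n powr (- \<sigma>))"
proof (rule summable_comparison_test')
  show "summable (\<lambda>n. ln (real n) * real n powr (- \<sigma>))" using assms by (rule summable_ln_powr)
  fix n :: nat assume "n \<ge> 1"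
  then show "norm (mangoldt n * real n powr (- \<sigma>)) \<le> ln (real n) * real n powr (- \<sigma>)"
    using mangoldt_le[of n] mangoldt_nonneg[of n] by (auto simp: abs_mult intro!: mult_right_mono)
qed

lemma norm_of_nat_powr: "norm (of_nat n powr s :: complex) = real n powr Re s"
  by (simp add: norm_powr_real_powr)

lemma abs_summable_mangoldt:
  assumes "Re s > 1"
  shows "summable (\<lambda>n. norm (mangoldt n * of_nat n powr (- s) :: complex))"
  using summable_mangoldt_powr[OF assms] by (simp add: norm_mult norm_of_nat_powr)

lemma zeta_series_aux:
  "\<exists>g g'. \<forall>s\<in>{s. Re s > 1}. ((\<lambda>n. of_nat n powr (- s)) sums g s) \<and>
      ((\<lambda>n. - (of_real (ln (real n)) * of_nat n powr (- s))) sums g' s) \<and> (g has_field_derivative g' s) (at s)"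
proof (rule series_and_derivative_comparison_local)
  show "open {s. Re s > 1}" by (rule open_halfspace_Re_gt)
  show "((\<lambda>s. of_nat n powr (- s)) has_field_derivative - (of_real (ln (real n)) * of_nat n powr (- s))) (at s)"
    for n and s :: complex
  proof (cases "n = 0")
    case False
    then have "((\<lambda>s. of_nat n powr (- s)) has_field_derivative (Ln (of_nat n) * of_nat n powr (- s)) * (- 1)) (at s)"
      by (intro DERIV_chain2[where f = "\<lambda>w. of_nat n powr w"] has_field_derivative_powr_right derivative_eq_intros) auto
    then show ?thesis using False by (simp add: Ln_of_nat)
  qed auto
  show "\<exists>d h. 0 < d \<and> summable h \<and> (\<forall>\<^sub>F n in sequentially. \<forall>t\<in>ball s d \<inter> {s. Re s > 1}. norm (of_nat n powr (- t) :: complex) \<le> h n)"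
    if "s \<in> {s. Re s > 1}" for s
  proof -
    define d where "d = (Re s - 1) / 2"
    have d: "d > 0" using that by (simp add: d_def)
    have h: "summable (\<lambda>n. real n powr (- 1 - d))" using d by (simp add: summable_real_powr_iff)
    have "norm (of_nat n powr (- t) :: complex) \<le> real n powr (- 1 - d)" if "t \<in> ball s d" "n > 0" for n t
    proof -
      have st: "norm (s - t) < d" using that by (simp add: dist_norm)
      have Re: "- Re t \<le> - 1 - d" using st complex_Re_le_cmod[of "s - t"] by (simp add: d_def field_simps)
      then show ?thesis using that(2) by (auto simp: norm_of_nat_powr intro!: powr_mono)
    qed
    then show ?thesis using d h
      by (intro exI[of _ d] exI[of _ "\<lambda>n. real n powr (- 1 - d)"] conjI eventually_mono[OF eventually_gt_at_top[of 0]]) auto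
  qed
qed

lemma zeta_series_deriv:
  assumes "Re s > 1"
  shows "(zeta_series has_field_derivative - (\<Sum>n. of_real (ln (real n)) * of_nat n powr (- s))) (at s)"
proof -
  obtain g g' where g: "\<And>s. Re s > 1 \<Longrightarrow> (\<lambda>n. of_nat n powr (- s)) sums g s"
      "\<And>s. Re s > 1 \<Longrightarrow> (\<lambda>n. - (of_real (ln (real n)) * of_nat n powr (- s))) sums g' s"
      "\<And>s. Re s > 1 \<Longrightarrow> (g has_field_derivative g' s) (at s)"
    using zeta_series_aux by auto
  have gd: "g t = zeta_series t" if "Re t > 1" for t
    using g(1)[OF that] by (simp add: zeta_series_def sums_iff)
  have "(zeta_series has_field_derivative g' s) (at s)"
    by (rule has_field_derivative_transform_within_open[OF g(3)[OF assms] open_halfspace_Re_gt[of 1]])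
      (use assms gd in auto)
  moreover have "g' s = - (\<Sum>n. of_real (ln (real n)) * of_nat n powr (- s))"
    using sums_minus[OF g(2)[OF assms]] by (simp add: sums_iff)
  ultimately show ?thesis by simp
qed

text \<open>Passes to unordered sums over the positive integers, where the product of two Dirichlet
  series can be rearranged.\<close>

lemma has_sum_pos_nat:
  fixes f :: "nat \<Rightarrow> 'a :: banach"
  assumes "summable (\<lambda>n. norm (f n))" "f 0 = 0"
  shows "(f has_sum (\<Sum>n. f n)) {1..}"
proof -
  have "(f has_sum (\<Sum>n. f n)) UNIV"
    using assms(1) by (intro norm_summable_imp_has_sum summable_sums) (auto dest: summable_norm_cancel)
  then show ?thesis
    by (subst has_sum_cong_neutral[where T = UNIV and g = f]) (use assms(2) in \<open>auto simp: not_le\<close>)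
qed

text \<open>Dirichlet convolution: the absolutely convergent double sum over \<open>(d, m)\<close>
  is grouped by \<open>n = d * m\<close>, and the sum of the von Mangoldt function over the divisors
  of \<open>n\<close> is \<open>ln n\<close>.\<close>

lemma mangoldt_series_mult_zeta_series:
  assumes s: "Re s > 1"
  shows "mangoldt_series s * zeta_series s = (\<Sum>n. of_real (ln (real n)) * of_nat n powr (- s))"
proof -
  define f where "f n = mangoldt n * of_nat n powr (- s)" for n
  define g where "g n = (of_nat n powr (- s) :: complex)" for n
  define L where "L n = complex_of_real (ln (real n)) * of_nat n powr (- s)" for n
  have f: "(f has_sum mangoldt_series s) {1..}"
    unfolding mangoldt_series_def f_def
    by (rule has_sum_pos_nat[OF abs_summable_mangoldt[OF s]]) auto
  have g: "(g has_sum zeta_series s) {1..}"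
    unfolding zeta_series_def g_def by (rule has_sum_pos_nat[OF summable_zeta_series[OF s]]) auto
  have nf: "(\<lambda>n. norm (f n)) summable_on {1..}"
    using has_sum_pos_nat[of "\<lambda>n. norm (f n)"] abs_summable_mangoldt[OF s]
    by (auto simp: f_def summable_on_def)
  have ng: "(\<lambda>n. norm (g n)) summable_on {1..}"
    using has_sum_pos_nat[of "\<lambda>n. norm (g n)"] summable_zeta_series[OF s]
    by (auto simp: g_def summable_on_def)
  have "(\<lambda>p. norm (f (fst p) * g (snd p))) summable_on {1..} \<times> {1..}"
  proof (rule summable_on_SigmaI)
    show "((\<lambda>y. norm (f (fst (x, y)) * g (snd (x, y)))) has_sum (norm (f x) * infsum (\<lambda>n. norm (g n)) {1..})) {1..}" for x
      using has_sum_cmult_right[OF has_sum_infsum[OF ng]] by (simp add: norm_mult)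
    show "(\<lambda>x. norm (f x) * infsum (\<lambda>n. norm (g n)) {1..}) summable_on {1..}"
      using nf by (rule summable_on_cmult_left)
  qed auto
  then have sm: "(\<lambda>p. f (fst p) * g (snd p)) summable_on {1..} \<times> {1..}"
    by (rule abs_summable_summable)
  have "((\<lambda>p. f (fst p) * g (snd p)) has_sum (mangoldt_series s * zeta_series s)) ({1..} \<times> {1..})"
    using sm by (rule has_sum_SigmaI[rotated 2])
      (use has_sum_cmult_right[OF g] has_sum_cmult_left[OF f] in auto)
  also have "?this \<longleftrightarrow> ((\<lambda>(n, d). mangoldt d * of_nat n powr (- s)) has_sum (mangoldt_series s * zeta_series s))
      (Sigma {1..} (\<lambda>n. {d. d dvd n}))"
  proof (rule has_sum_reindex_bij_witness[where j = "\<lambda>(d, m). (d * m, d)" and i = "\<lambda>(n, d). (d, n div d)"])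
    show "(case case p of (d, m) \<Rightarrow> (d * m, d) of (n, d) \<Rightarrow> mangoldt d * of_nat n powr (- s)) = f (fst p) * g (snd p)"
      if "p \<in> {1..} \<times> {1..}" for p
      using that by (auto simp: f_def g_def powr_times_real)
  next
    fix b :: "nat \<times> nat" assume b: "b \<in> (SIGMA n:{1..}. {d. d dvd n})"
    then obtain n d where "b = (n, d)" "n \<ge> 1" "d dvd n" by auto
    then show "(case b of (n, d) \<Rightarrow> (d, n div d)) \<in> {1..} \<times> {1..}"
      by (auto elim!: dvdE simp: Suc_le_eq)
  qed auto
  finally have "((\<lambda>n. \<Sum>d | d dvd n. mangoldt d * of_nat n powr (- s)) has_sum (mangoldt_series s * zeta_series s)) {1..}"
    by (rule has_sum_Sigma') (auto intro!: has_sum_finite finite_divisors_nat)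
  also have "?this \<longleftrightarrow> (L has_sum (mangoldt_series s * zeta_series s)) {1..}"
  proof (rule has_sum_cong)
    fix n :: nat assume "n \<in> {1..}"
    then show "(\<Sum>d | d dvd n. mangoldt d * of_nat n powr (- s)) = L n"
      using mangoldt_sum[of n, where 'a = complex] by (simp add: L_def flip: sum_distrib_right)
  qed
  finally have 1: "(L has_sum (mangoldt_series s * zeta_series s)) {1..}" .
  have "summable (\<lambda>n. norm (L n))"
  proof -
    have "(\<lambda>n. norm (L n)) = (\<lambda>n. ln (real n) * real n powr (- Re s))"
    proof
      fix n show "norm (L n) = ln (real n) * real n powr (- Re s)"
        by (cases "n = 0") (auto simp: L_def norm_mult norm_of_nat_powr)
    qed
    then show ?thesis using summable_ln_powr[OF s] by simp
  qed
  then have "(L has_sum (\<Sum>n. L n)) {1..}" by (rule has_sum_pos_nat) (simp add: L_def)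
  with 1 show ?thesis unfolding L_def by (rule has_sum_unique)
qed

text \<open>The logarithmic derivative of \<open>zeta_reg s = (s - 1) * zeta_series s\<close> is
  \<open>1 / (s - 1)\<close> from the first factor minus \<open>mangoldt_series s\<close> from the
  second.\<close>

lemma mangoldt_series_eq:
  assumes s: "Re s > 1" and nz: "zeta_reg s \<noteq> 0"
  shows "mangoldt_series s = 1 / (s - 1) - deriv zeta_reg s / zeta_reg s"
proof -
  have s1: "s \<noteq> 1" using s by auto
  have d: "(zeta_series has_field_derivative - (mangoldt_series s * zeta_series s)) (at s)"
    using zeta_series_deriv[OF s] mangoldt_series_mult_zeta_series[OF s] by simp
  have "((\<lambda>s. (s - 1) * zeta_series s) has_field_derivative (zeta_series s - (s - 1) * (mangoldt_series s * zeta_series s))) (at s)"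
    by (rule derivative_eq_intros d refl)+ (simp add: algebra_simps)
  then have "(zeta_reg has_field_derivative (zeta_series s - (s - 1) * (mangoldt_series s * zeta_series s))) (at s)"
    by (rule has_field_derivative_transform_within_open[OF _ open_halfspace_Re_gt[of 1]])
      (use s zeta_reg_eq in auto)
  then have "deriv zeta_reg s = zeta_series s - (s - 1) * (mangoldt_series s * zeta_series s)"
    by (rule DERIV_imp_deriv)
  then show ?thesis using nz s1 by (simp add: zeta_reg_eq[OF s] divide_simps)
qed

text \<open>The limit is the order of vanishing at \<open>z\<close>. Approaching from the right keeps the points in the
  half-plane of convergence of the Dirichlet series.\<close>

lemma log_deriv_limit_at_right:
  assumes hol: "f holomorphic_on S" and S: "open S" "connected S" and z: "z \<in> S" and nc: "\<exists>w\<in>S. f w \<noteq> 0"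
  obtains m :: nat where "m = 0 \<longleftrightarrow> f z \<noteq> 0"
    "((\<lambda>e. of_real e * (deriv f (z + of_real e) / f (z + of_real e))) \<longlongrightarrow> of_nat m) (at_right 0)"
    "\<forall>\<^sub>F e in at_right 0. f (z + of_real e) \<noteq> 0"
proof -
  define n where "n = nat (zorder f z)"
  define g where "g = zor_poly f z"
  from zorder_exist_zero[OF hol S z nc]
  obtain r where r: "r > 0" "cball z r \<subseteq> S" "g holomorphic_on cball z r"
      "\<And>w. w \<in> cball z r \<Longrightarrow> f w = g w * (w - z) ^ n \<and> g w \<noteq> 0"
      and n: "if f z = 0 then zorder f z > 0 else zorder f z = 0"
    unfolding n_def g_def by blast
  have hg: "g holomorphic_on ball z r" using r(3) by (rule holomorphic_on_subset) auto
  have ev: "\<forall>\<^sub>F e in at_right (0::real). 0 < e \<and> e < r"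
    using r(1) by (auto simp: eventually_at_right_field)
  \<comment> \<open>From \<open>f w = g w * (w - z) ^ n\<close> with \<open>w - z = e\<close>, the
    logarithmic derivative is \<open>n / e\<close> plus that of the nonvanishing factor
    \<open>g\<close>.\<close>
  have eq: "of_real e * (deriv f (z + of_real e) / f (z + of_real e)) =
      of_nat n + of_real e * (deriv g (z + of_real e) / g (z + of_real e))" if e: "0 < e" "e < r" for e
  proof -
    define w where "w = z + complex_of_real e"
    have w: "w \<in> ball z r" "w - z = of_real e" using e by (auto simp: w_def dist_norm)
    have dg: "(g has_field_derivative deriv g w) (at w)"
      using hg w(1) holomorphic_derivI open_ball by blast
    have "((\<lambda>w. g w * (w - z) ^ n) has_field_derivative
        (deriv g w * (w - z) ^ n + g w * (of_nat n * (w - z) ^ (n - 1)))) (at w)"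
      by (rule derivative_eq_intros dg refl)+ (simp add: algebra_simps)
    then have "(f has_field_derivative (deriv g w * (w - z) ^ n + g w * (of_nat n * (w - z) ^ (n - 1)))) (at w)"
      by (rule has_field_derivative_transform_within_open[OF _ open_ball[of z r]]) (use w r(4) in auto)
    then have "deriv f w = deriv g w * (w - z) ^ n + g w * (of_nat n * (w - z) ^ (n - 1))"
      by (rule DERIV_imp_deriv)
    moreover have "f w = g w * (w - z) ^ n" "g w \<noteq> 0" using r(4)[of w] w by auto
    \<comment> \<open>For \<open>n = 0\<close> the exponent \<open>n - 1\<close> is truncated, but
      the factor \<open>of_nat n\<close> makes both sides zero.\<close>
    moreover have "of_real e * (g w * (of_nat n * of_real e ^ (n - 1))) = of_nat n * (g w * of_real e ^ n)"
      by (cases n) auto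
    ultimately have "of_real e * (deriv f w / f w) = of_nat n + of_real e * (deriv g w / g w)"
      using e by (simp add: w(2) divide_simps) (simp add: algebra_simps)
    then show ?thesis by (simp add: w_def)
  qed
  show ?thesis
  proof (rule that[of n])
    show "n = 0 \<longleftrightarrow> f z \<noteq> 0" using n by (auto simp: n_def split: if_splits)
    show "\<forall>\<^sub>F e in at_right 0. f (z + of_real e) \<noteq> 0"
      using ev
    proof eventually_elim
      case (elim e)
      then show ?case using r(4)[of "z + of_real e"] by (auto simp: dist_norm)
    qed
    have "isCont (\<lambda>w. deriv g w / g w) z"
      using r holomorphic_on_imp_continuous_on[OF hg] holomorphic_on_imp_continuous_on[OF holomorphic_deriv[OF hg open_ball]]
      by (intro continuous_intros) (auto simp: continuous_on_eq_continuous_at)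
    moreover have "((\<lambda>e. z + of_real e) \<longlongrightarrow> z) (at_right (0::real))"
      by (rule tendsto_eq_intros refl)+ auto
    ultimately have *: "((\<lambda>e. deriv g (z + of_real e) / g (z + of_real e)) \<longlongrightarrow> deriv g z / g z) (at_right 0)"
      by (rule isCont_tendsto_compose)
    have L: "((\<lambda>e. of_nat n + of_real e * (deriv g (z + of_real e) / g (z + of_real e))) \<longlongrightarrow>
       of_nat n + of_real 0 * (deriv g z / g z)) (at_right 0)"
      by (rule tendsto_add[OF tendsto_const tendsto_mult[OF tendsto_of_real[OF tendsto_ident_at] *]])
    have "((\<lambda>e. of_real e * (deriv f (z + of_real e) / f (z + of_real e))) \<longlongrightarrow>
       of_nat n + of_real 0 * (deriv g z / g z)) (at_right 0)"
      by (rule Lim_transform_eventually[OF L eventually_mono[OF ev]]) (use eq in metis)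
    then show "((\<lambda>e. of_real e * (deriv f (z + of_real e) / f (z + of_real e))) \<longlongrightarrow> of_nat n) (at_right 0)"
      by simp
  qed
qed

text \<open>Multiply \<open>mangoldt_series_eq\<close> by \<open>e\<close>: the pole term
  contributes 1 at \<open>s = 1\<close> and 0 elsewhere, and the other term tends to minus the order
  of vanishing of \<open>zeta_reg\<close>. Zeros are isolated because \<open>zeta_reg 1 = 1\<close>,
  so the formula is available for all small \<open>e > 0\<close>, even if \<open>s\<close> itself is
  a zero.\<close>

lemma mangoldt_series_limit:
  assumes s: "Re s \<ge> 1"
  obtains m :: nat where "m = 0 \<longleftrightarrow> zeta_reg s \<noteq> 0"
    "((\<lambda>e. of_real e * mangoldt_series (s + of_real e)) \<longlongrightarrow> (if s = 1 then 1 else 0) - of_nat m) (at_right 0)"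
proof -
  have 1: "\<exists>w\<in>{s. Re s > 0}. zeta_reg w \<noteq> 0" by (rule bexI[of _ 1]) (auto simp: zeta_reg_1)
  have 2: "s \<in> {s. Re s > 0}" using s by simp
  obtain m :: nat where m: "m = 0 \<longleftrightarrow> zeta_reg s \<noteq> 0"
    "((\<lambda>e. of_real e * (deriv zeta_reg (s + of_real e) / zeta_reg (s + of_real e))) \<longlongrightarrow> of_nat m) (at_right 0)"
    "\<forall>\<^sub>F e in at_right 0. zeta_reg (s + of_real e) \<noteq> 0"
    by (rule log_deriv_limit_at_right[OF zeta_reg_holomorphic open_halfspace_Re_gt
        convex_connected[OF convex_halfspace_Re_gt] 2 1])
  have lim: "((\<lambda>e. of_real e / (s - 1 + of_real e)) \<longlongrightarrow> (if s = 1 then 1 else 0)) (at_right (0::real))"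
  proof (cases "s = 1")
    case True
    have "\<forall>\<^sub>F e in at_right (0::real). of_real e / (s - 1 + of_real e) = 1"
      using True by (auto simp: eventually_at_right_field intro!: exI[of _ 1])
    then show ?thesis using True by (simp add: tendsto_eventually)
  next
    case False
    have "((\<lambda>e. of_real e / (s - 1 + of_real e)) \<longlongrightarrow> of_real 0 / (s - 1 + of_real 0)) (at_right (0::real))"
      using False by (intro tendsto_intros) auto
    then show ?thesis using False by simp
  qed
  have "((\<lambda>e. of_real e / (s - 1 + of_real e) - of_real e * (deriv zeta_reg (s + of_real e) / zeta_reg (s + of_real e)))
      \<longlongrightarrow> (if s = 1 then 1 else 0) - of_nat m) (at_right 0)"
    by (intro tendsto_diff lim m(2))
  moreover have "\<forall>\<^sub>F e in at_right 0. of_real e / (s - 1 + of_real e) - of_real e * (deriv zeta_reg (s + of_real e) / zeta_reg (s + of_real e))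
     = of_real e * mangoldt_series (s + of_real e)"
    using m(3) eventually_at_right_less
  proof eventually_elim
    case (elim e)
    have "mangoldt_series (s + of_real e) = 1 / (s + of_real e - 1) - deriv zeta_reg (s + of_real e) / zeta_reg (s + of_real e)"
      by (rule mangoldt_series_eq) (use elim s in auto)
    moreover have "s + of_real e - 1 = s - 1 + of_real e" by simp
    ultimately show ?case by (simp add: right_diff_distrib)
  qed
  ultimately have "((\<lambda>e. of_real e * mangoldt_series (s + of_real e)) \<longlongrightarrow> (if s = 1 then 1 else 0) - of_nat m) (at_right 0)"
    by (rule Lim_transform_eventually)
  with m(1) show ?thesis by (rule that)
qed

section \<open>Nonvanishing by the 3-4-1 inequality\<close>

lemma three_four_one:
  fixes x :: real
  shows "3 + 4 * cos x + cos (2 * x) \<ge> 0"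
proof -
  have "3 + 4 * cos x + cos (2 * x) = 2 * (1 + cos x)\<^sup>2"
    unfolding cos_double_cos by (simp add: power2_eq_square algebra_simps)
  then show ?thesis by simp
qed

lemma Re_mangoldt_series:
  assumes "\<sigma> > 1"
  shows "(\<lambda>n. mangoldt n * real n powr (- \<sigma>) * cos (t * ln (real n))) sums Re (mangoldt_series (Complex \<sigma> t))"
proof -
  have "(\<lambda>n. mangoldt n * of_nat n powr (- Complex \<sigma> t)) sums mangoldt_series (Complex \<sigma> t)"
    unfolding mangoldt_series_def
    by (intro summable_sums summable_norm_cancel[OF abs_summable_mangoldt]) (use assms in auto)
  then have "(\<lambda>n. Re (mangoldt n * of_nat n powr (- Complex \<sigma> t))) sums Re (mangoldt_series (Complex \<sigma> t))"
    by (rule sums_Re)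
  moreover have "Re (mangoldt n * of_nat n powr (- Complex \<sigma> t)) = mangoldt n * real n powr (- \<sigma>) * cos (t * ln (real n))" for n
  proof (cases "n = 0")
    case False
    have "- Complex \<sigma> t * of_real (ln (real n)) = Complex (- \<sigma> * ln (real n)) (- (t * ln (real n)))"
      by (simp add: complex_eq_iff)
    with False have "of_nat n powr (- Complex \<sigma> t) = exp (Complex (- \<sigma> * ln (real n)) (- (t * ln (real n))))"
      by (simp add: powr_def Ln_of_nat)
    then show ?thesis using False by (simp add: Re_exp powr_def)
  qed auto
  ultimately show ?thesis by (simp only:)
qed

lemma norm_mangoldt_series_le:
  assumes "1 < a" "a \<le> Re s"
  shows "norm (mangoldt_series s) \<le> (\<Sum>n. mangoldt n * real n powr (- a))"
  unfolding mangoldt_series_def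
proof (rule norm_suminf_le)
  show "norm (mangoldt n * of_nat n powr (- s) :: complex) \<le> mangoldt n * real n powr (- a)" for n
    using assms mangoldt_nonneg[of n]
    by (cases "n = 0") (auto simp: norm_mult norm_of_nat_powr intro!: mult_left_mono powr_mono)
qed (use assms summable_mangoldt_powr in auto)

text \<open>For \<open>Re s > 1\<close> the series stays bounded near \<open>s\<close>, so the order
  of vanishing is 0. On the line, let \<open>m1\<close> and \<open>m2\<close> be the orders at
  \<open>1 + i t\<close> and \<open>1 + i (2 t)\<close> with \<open>t\<close> nonzero. The
  combination with weights 3, 4, 1 at the points 1, \<open>1 + i t\<close>,
  \<open>1 + i (2 t)\<close> has nonnegative real part by \<open>three_four_one\<close>, and its
  limit is \<open>3 - 4 * m1 - m2\<close>. As \<open>m1\<close> is an integer, it is 0.\<close>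

theorem zeta_reg_nonzero:
  assumes s: "Re s \<ge> 1"
  shows "zeta_reg s \<noteq> 0"
proof (cases "Re s > 1")
  case True
  obtain m where m: "m = 0 \<longleftrightarrow> zeta_reg s \<noteq> 0"
    "((\<lambda>e. of_real e * mangoldt_series (s + of_real e)) \<longlongrightarrow> (if s = 1 then 1 else 0) - of_nat m) (at_right 0)"
    by (rule mangoldt_series_limit[OF s])
  have "((\<lambda>e. of_real e * mangoldt_series (s + of_real e)) \<longlongrightarrow> 0) (at_right 0)"
  proof (rule Lim_null_comparison)
    show "\<forall>\<^sub>F e in at_right 0. norm (of_real e * mangoldt_series (s + of_real e)) \<le> e * (\<Sum>n. mangoldt n * real n powr (- Re s))"
      using eventually_at_right_less[of "0::real"]
    proof eventually_elim
      case (elim e)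
      then show ?case using True norm_mangoldt_series_le[of "Re s" "s + of_real e"]
        by (auto simp: norm_mult intro!: mult_left_mono)
    qed
    show "((\<lambda>e. e * (\<Sum>n. mangoldt n * real n powr (- Re s))) \<longlongrightarrow> 0) (at_right 0)"
      by (rule tendsto_eq_intros refl)+ auto
  qed
  from tendsto_unique[OF _ m(2) this] True have "of_nat m = (0::complex)" by (auto split: if_splits)
  with m(1) show ?thesis by simp
next
  case False
  define t where "t = Im s"
  have seq: "s = Complex 1 t" using s False by (simp add: t_def complex_eq_iff)
  show ?thesis
  proof (cases "t = 0")
    case True
    then have "s = 1" using seq by (simp add: complex_eq_iff)
    then show ?thesis by (simp add: zeta_reg_1)
  next
    case t: False
    have r1: "Re 1 \<ge> 1" and r2: "Re (Complex 1 (2*t)) \<ge> 1" by simp_all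
    obtain m0 where m0: "m0 = 0 \<longleftrightarrow> zeta_reg 1 \<noteq> 0"
      "((\<lambda>e. of_real e * mangoldt_series (1 + of_real e)) \<longlongrightarrow> (if 1 = (1::complex) then 1 else 0) - of_nat m0) (at_right 0)"
      by (rule mangoldt_series_limit[OF r1])
    obtain m1 where m1: "m1 = 0 \<longleftrightarrow> zeta_reg s \<noteq> 0"
      "((\<lambda>e. of_real e * mangoldt_series (s + of_real e)) \<longlongrightarrow> (if s = 1 then 1 else 0) - of_nat m1) (at_right 0)"
      by (rule mangoldt_series_limit[OF s])
    obtain m2 :: nat where m2:
      "((\<lambda>e. of_real e * mangoldt_series (Complex 1 (2*t) + of_real e)) \<longlongrightarrow> (if Complex 1 (2*t) = 1 then 1 else 0) - of_nat m2) (at_right 0)"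
      by (rule mangoldt_series_limit[OF r2])
    let ?F = "\<lambda>e. 3 * (of_real e * mangoldt_series (1 + of_real e)) + 4 * (of_real e * mangoldt_series (s + of_real e))
          + of_real e * mangoldt_series (Complex 1 (2*t) + of_real e)"
    have "(?F \<longlongrightarrow> 3 * ((if 1 = (1::complex) then 1 else 0) - of_nat m0) + 4 * ((if s = 1 then 1 else 0) - of_nat m1)
        + ((if Complex 1 (2*t) = 1 then 1 else 0) - of_nat m2)) (at_right 0)"
      by (intro tendsto_add tendsto_mult[OF tendsto_const] m0(2) m1(2) m2)
    then have "((\<lambda>e. Re (?F e)) \<longlongrightarrow> Re (3 * ((if 1 = (1::complex) then 1 else 0) - of_nat m0) + 4 * ((if s = 1 then 1 else 0) - of_nat m1)
        + ((if Complex 1 (2*t) = 1 then 1 else 0) - of_nat m2))) (at_right 0)"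
      by (rule tendsto_Re)
    also have "Re (3 * ((if 1 = (1::complex) then 1 else 0) - of_nat m0) + 4 * ((if s = 1 then 1 else 0) - of_nat m1)
        + ((if Complex 1 (2*t) = 1 then 1 else 0) - of_nat m2)) = 3 - 4 * real m1 - real m2"
      using m0(1) t seq by (auto simp: zeta_reg_1 complex_eq_iff)
    finally have lim: "((\<lambda>e. Re (?F e)) \<longlongrightarrow> 3 - 4 * real m1 - real m2) (at_right 0)" .
    have "\<forall>\<^sub>F e in at_right 0. Re (?F e) \<ge> 0"
      using eventually_at_right_less[of "0::real"]
    proof eventually_elim
      case (elim e)
      then have e: "1 + e > 1" by simp
      let ?a = "\<lambda>n. mangoldt n * real n powr (- (1 + e))"
      have S: "(\<lambda>n. 3 * (?a n * cos (0 * ln (real n))) + 4 * (?a n * cos (t * ln (real n))) + ?a n * cos ((2 * t) * ln (real n))) sums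
          (3 * Re (mangoldt_series (Complex (1 + e) 0)) + 4 * Re (mangoldt_series (Complex (1 + e) t)) + Re (mangoldt_series (Complex (1 + e) (2*t))))"
        by (intro sums_add sums_mult Re_mangoldt_series e)
      have P: "0 \<le> 3 * (?a n * cos (0 * ln (real n))) + 4 * (?a n * cos (t * ln (real n))) + ?a n * cos ((2 * t) * ln (real n))" for n
      proof -
        have "0 \<le> ?a n * (3 + 4 * cos (t * ln (real n)) + cos (2 * (t * ln (real n))))"
          by (intro mult_nonneg_nonneg three_four_one mangoldt_nonneg) auto
        then show ?thesis by (simp add: algebra_simps)
      qed
      have "0 \<le> 3 * Re (mangoldt_series (Complex (1 + e) 0)) + 4 * Re (mangoldt_series (Complex (1 + e) t)) + Re (mangoldt_series (Complex (1 + e) (2*t)))"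
        by (rule sums_le[OF P sums_zero S])
      then have "0 \<le> e * (3 * Re (mangoldt_series (Complex (1 + e) 0)) + 4 * Re (mangoldt_series (Complex (1 + e) t)) + Re (mangoldt_series (Complex (1 + e) (2*t))))"
        using elim by simp
      also have "\<dots> = Re (?F e)"
      proof -
        have 1: "1 + of_real e = Complex (1 + e) 0" "s + of_real e = Complex (1 + e) t"
            "Complex 1 (2*t) + of_real e = Complex (1 + e) (2*t)"
          using seq by (auto simp: complex_eq_iff)
        show ?thesis unfolding 1 by (simp add: algebra_simps)
      qed
      finally show ?case .
    qed
    from tendsto_lowerbound[OF lim this] have "3 - 4 * real m1 - real m2 \<ge> 0" by simp
    then have "4 * m1 + m2 \<le> 3" by linarith
    then have "m1 = 0" by simp
    then show ?thesis using m1(1) by simp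
  qed
qed

section \<open>Smoothing with the Fejer kernel\<close>

text \<open>Both series have the same polar part \<open>1 / (s - 1)\<close>, which cancels in the
  difference. What remains of zeta is the difference quotient \<open>q\<close> of
  \<open>zeta_reg\<close> at 1, with its removable singularity filled in; what remains of the other
  is holomorphic wherever \<open>zeta_reg\<close> has no zero.\<close>

lemma mangoldt_minus_zeta_series_extends:
  "\<exists>G U. open U \<and> {s. Re s \<ge> 1} \<subseteq> U \<and> G holomorphic_on U \<and>
     (\<forall>s. Re s > 1 \<longrightarrow> G s = mangoldt_series s - zeta_series s)"
proof -
  define U where "U = {s. Re s > 0} \<inter> {s. Re s > 0 \<and> zeta_reg s \<noteq> 0}"
  define q where "q = (\<lambda>s. if s = 1 then deriv zeta_reg 1 else (zeta_reg s - zeta_reg 1) / (s - 1))"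
  have oH: "open {s. Re s > 0}" by (rule open_halfspace_Re_gt)
  have cont: "continuous_on {s. Re s > 0} zeta_reg"
    using zeta_reg_holomorphic by (rule holomorphic_on_imp_continuous_on)
  have U: "open U"
  proof -
    have "open ({s. Re s > 0} \<inter> zeta_reg -` (- {0}))"
      by (rule continuous_open_preimage[OF cont oH]) auto
    moreover have "U = {s. Re s > 0} \<inter> zeta_reg -` (- {0})" by (auto simp: U_def)
    ultimately show ?thesis by simp
  qed
  have sub: "U \<subseteq> {s. Re s > 0}" by (auto simp: U_def)
  have q: "q holomorphic_on U"
    unfolding q_def by (rule holomorphic_on_subset[OF pole_lemma_open[OF zeta_reg_holomorphic oH] sub])
  have Z: "zeta_reg holomorphic_on U" using zeta_reg_holomorphic sub by (rule holomorphic_on_subset)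
  have "(\<lambda>s. - q s - deriv zeta_reg s / zeta_reg s) holomorphic_on U"
    by (intro holomorphic_intros q Z holomorphic_deriv U) (auto simp: U_def)
  moreover have "{s. Re s \<ge> 1} \<subseteq> U" using zeta_reg_nonzero by (auto simp: U_def)
  moreover have "- q s - deriv zeta_reg s / zeta_reg s = mangoldt_series s - zeta_series s" if "Re s > 1" for s
  proof -
    have s: "s \<noteq> 1" "zeta_reg s \<noteq> 0" using that zeta_reg_nonzero[of s] by auto
    then have "mangoldt_series s - zeta_series s = 1 / (s - 1) - deriv zeta_reg s / zeta_reg s - zeta_series s"
      using mangoldt_series_eq that by simp
    moreover have "q s = zeta_series s - 1 / (s - 1)"
      using s(1) zeta_reg_eq[OF that] by (simp add: q_def zeta_reg_1 diff_divide_distrib)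
    ultimately show ?thesis by simp
  qed
  ultimately show ?thesis using U by blast
qed

text \<open>Quantitative Riemann-Lebesgue lemma, by one integration by parts. Only bounds on
  \<open>f\<close> and \<open>f'\<close> enter, so the estimate can be applied uniformly to a family
  of functions.\<close>

lemma oscillatory_integral_bound:
  fixes f f' :: "real \<Rightarrow> complex"
  assumes ab: "a \<le> b" and y: "y \<noteq> 0"
    and df: "\<And>t. t \<in> {a..b} \<Longrightarrow> (f has_vector_derivative f' t) (at t within {a..b})"
    and cf': "continuous_on {a..b} f'"
    and M: "\<And>t. t \<in> {a..b} \<Longrightarrow> norm (f t) \<le> M" and M': "\<And>t. t \<in> {a..b} \<Longrightarrow> norm (f' t) \<le> M'"
  shows "norm (integral {a..b} (\<lambda>t. cis (t * y) * f t)) \<le> (2 * M + M' * (b - a)) / \<bar>y\<bar>"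
proof -
  define c where "c = 1 / (\<i> * of_real y)"
  have nc: "norm c = 1 / \<bar>y\<bar>" by (simp add: c_def norm_divide norm_mult)
  have cy: "c * (\<i> * of_real y) = 1" using y by (simp add: c_def)
  define h where "h t = c * cis (t * y) * f t" for t
  have dcis: "((\<lambda>t. cis (t * y)) has_vector_derivative (\<i> * of_real y * cis (t * y))) (at t within {a..b})" for t
    unfolding has_vector_derivative_complex_iff by (auto intro!: derivative_eq_intros)
  have ccis: "continuous_on {a..b} (\<lambda>t. cis (t * y))"
    by (intro continuous_intros)
  have "(h has_vector_derivative (cis (t * y) * f t + c * cis (t * y) * f' t)) (at t within {a..b})" if "t \<in> {a..b}" for t
  proof -
    have "(h has_vector_derivative (c * cis (t * y) * f' t + (c * (\<i> * of_real y * cis (t * y))) * f t)) (at t within {a..b})"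
      unfolding h_def
      by (intro has_vector_derivative_mult[OF has_vector_derivative_mult_right[OF dcis] df[OF that]])
    moreover have "(c * (\<i> * of_real y * cis (t * y))) * f t = (c * (\<i> * of_real y)) * (cis (t * y) * f t)"
      by (simp only: mult_ac)
    ultimately show ?thesis unfolding cy by (simp add: add.commute)
  qed
  then have 1: "((\<lambda>t. cis (t * y) * f t + c * cis (t * y) * f' t) has_integral (h b - h a)) {a..b}"
    using ab by (intro fundamental_theorem_of_calculus)
  have 2: "(\<lambda>t. c * cis (t * y) * f' t) integrable_on {a..b}"
    by (intro integrable_continuous_real continuous_intros cf' ccis)
  have "((\<lambda>t. cis (t * y) * f t) has_integral (h b - h a - integral {a..b} (\<lambda>t. c * cis (t * y) * f' t))) {a..b}"
    using has_integral_diff[OF 1 integrable_integral[OF 2]] by simp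
  then have "integral {a..b} (\<lambda>t. cis (t * y) * f t) = h b - h a - integral {a..b} (\<lambda>t. c * cis (t * y) * f' t)"
    by (rule integral_unique)
  also have "norm \<dots> \<le> norm (h b) + norm (h a) + norm (integral {a..b} (\<lambda>t. c * cis (t * y) * f' t))"
    by (intro norm_triangle_le_diff add_right_mono) auto
  also have "norm (integral {a..b} (\<lambda>t. c * cis (t * y) * f' t)) \<le> (1 / \<bar>y\<bar> * M') * (b - a)"
    by (rule integral_bound[OF ab])
      (use M' in \<open>auto simp: norm_mult nc divide_right_mono intro!: continuous_intros cf' ccis\<close>)
  also have "norm (h b) \<le> 1 / \<bar>y\<bar> * M" using M[of b] ab by (simp add: h_def norm_mult nc divide_right_mono)
  also have "norm (h a) \<le> 1 / \<bar>y\<bar> * M" using M[of a] ab by (simp add: h_def norm_mult nc divide_right_mono)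
  also have "1 / \<bar>y\<bar> * M + 1 / \<bar>y\<bar> * M + 1 / \<bar>y\<bar> * M' * (b - a) = (2 * M + M' * (b - a)) / \<bar>y\<bar>"
    using y by (simp add: field_simps)
  finally show ?thesis by simp
qed

text \<open>The cosine transform of the triangle \<open>1 - t / l\<close> on \<open>[0, l]\<close>,
  as \<open>has_integral_fejer\<close> shows. The value at 0 is the limit of the formula. The bulk
  lies within distance about \<open>1 / l\<close> of 0, at height about \<open>l\<close>.\<close>

definition fejer :: "real \<Rightarrow> real \<Rightarrow> real" where
  "fejer l u = (if u = 0 then l / 2 else (1 - cos (l * u)) / (l * u\<^sup>2))"

lemma has_integral_fejer:
  assumes l: "l > 0"
  shows "((\<lambda>t. (1 - t / l) * cos (t * u)) has_integral fejer l u) {0..l}"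
proof (cases "u = 0")
  case True
  have "((\<lambda>t. 1 - t / l) has_integral ((l - l\<^sup>2 / (2 * l)) - (0 - 0\<^sup>2 / (2 * l)))) {0..l}"
    using l by (intro fundamental_theorem_of_calculus[where f = "\<lambda>t. t - t\<^sup>2 / (2 * l)"])
      (auto intro!: derivative_eq_intros simp flip: has_real_derivative_iff_has_vector_derivative)
  then show ?thesis using True l by (simp add: fejer_def power2_eq_square)
next
  case False
  define F where "F t = (1 - t / l) * (sin (t * u) / u) - cos (t * u) / (l * u\<^sup>2)" for t
  have "((\<lambda>t. (1 - t / l) * cos (t * u)) has_integral (F l - F 0)) {0..l}"
  proof (rule fundamental_theorem_of_calculus)
    show "(F has_vector_derivative (1 - t / l) * cos (t * u)) (at t within {0..l})" for t
      unfolding F_def has_real_derivative_iff_has_vector_derivative[symmetric]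
      by (rule derivative_eq_intros refl | use False l in \<open>simp add: field_simps power2_eq_square\<close>)+
  qed (use l in auto)
  moreover have "F l - F 0 = fejer l u"
    using False l by (simp add: F_def fejer_def diff_divide_distrib)
  ultimately show ?thesis by simp
qed

text \<open>Up to the phase, the coefficients of \<open>mangoldt_series - zeta_series\<close> on the
  line \<open>Re s = \<sigma>\<close>. The index 0 contributes nothing, because
  \<open>0 powr x = 0\<close>.\<close>

definition osc_coeff :: "real \<Rightarrow> nat \<Rightarrow> real" where
  "osc_coeff \<sigma> n = (mangoldt n - 1) * real n powr (- \<sigma>)"

lemma summable_osc_coeff:
  assumes "\<sigma> > 1"
  shows "summable (\<lambda>n. \<bar>osc_coeff \<sigma> n\<bar>)"
proof (rule summable_comparison_test')
  show "summable (\<lambda>n. mangoldt n * real n powr (- \<sigma>) + real n powr (- \<sigma>))"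
    using assms by (intro summable_add summable_mangoldt_powr) (simp_all add: summable_real_powr_iff)
  fix n :: nat
  have "\<bar>mangoldt n - 1 :: real\<bar> \<le> mangoldt n + 1" using mangoldt_nonneg[of n] by linarith
  then have "\<bar>mangoldt n - 1 :: real\<bar> * real n powr (- \<sigma>) \<le> (mangoldt n + 1) * real n powr (- \<sigma>)"
    by (rule mult_right_mono) auto
  then show "norm \<bar>osc_coeff \<sigma> n\<bar> \<le> mangoldt n * real n powr (- \<sigma>) + real n powr (- \<sigma>)"
    by (simp add: osc_coeff_def abs_mult distrib_right)
qed

lemma osc_coeff_cos_sums:
  assumes "\<sigma> > 1"
  shows "(\<lambda>n. osc_coeff \<sigma> n * cos (t * (ln (real n) - y))) sums
    Re (cis (t * y) * (mangoldt_series (Complex \<sigma> t) - zeta_series (Complex \<sigma> t)))"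
proof -
  have "(\<lambda>n. mangoldt n * of_nat n powr (- Complex \<sigma> t)) sums mangoldt_series (Complex \<sigma> t)"
    unfolding mangoldt_series_def
    by (intro summable_sums summable_norm_cancel[OF abs_summable_mangoldt]) (use assms in auto)
  moreover have "(\<lambda>n. of_nat n powr (- Complex \<sigma> t)) sums zeta_series (Complex \<sigma> t)"
    unfolding zeta_series_def
    by (intro summable_sums summable_norm_cancel[OF summable_zeta_series]) (use assms in auto)
  ultimately have "(\<lambda>n. cis (t * y) * (mangoldt n * of_nat n powr (- Complex \<sigma> t) - of_nat n powr (- Complex \<sigma> t)))
     sums (cis (t * y) * (mangoldt_series (Complex \<sigma> t) - zeta_series (Complex \<sigma> t)))"
    by (intro sums_mult sums_diff)
  from sums_Re[OF this]
  have "(\<lambda>n. Re (cis (t * y) * (mangoldt n * of_nat n powr (- Complex \<sigma> t) - of_nat n powr (- Complex \<sigma> t))))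
     sums Re (cis (t * y) * (mangoldt_series (Complex \<sigma> t) - zeta_series (Complex \<sigma> t)))" .
  moreover have "Re (cis (t * y) * (mangoldt n * of_nat n powr (- Complex \<sigma> t) - of_nat n powr (- Complex \<sigma> t)))
      = osc_coeff \<sigma> n * cos (t * (ln (real n) - y))" for n
  proof (cases "n = 0")
    case False
    have "- Complex \<sigma> t * of_real (ln (real n)) = Complex (- \<sigma> * ln (real n)) (- (t * ln (real n)))"
      by (simp add: complex_eq_iff)
    with False have "of_nat n powr (- Complex \<sigma> t) = exp (Complex (- \<sigma> * ln (real n)) (- (t * ln (real n))))"
      by (simp add: powr_def Ln_of_nat)
    also have "\<dots> = of_real (real n powr (- \<sigma>)) * cis (- (t * ln (real n)))"
      using False by (simp add: exp_eq_polar powr_def)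
    finally have "cis (t * y) * (mangoldt n * of_nat n powr (- Complex \<sigma> t) - of_nat n powr (- Complex \<sigma> t))
        = of_real (osc_coeff \<sigma> n) * (cis (t * y) * cis (- (t * ln (real n))))"
      by (simp add: osc_coeff_def algebra_simps)
    also have "cis (t * y) * cis (- (t * ln (real n))) = cis (- (t * (ln (real n) - y)))"
      by (simp add: cis_mult algebra_simps)
    finally show ?thesis by simp
  qed (auto simp: osc_coeff_def)
  ultimately show ?thesis by (simp only:)
qed

text \<open>For fixed \<open>\<sigma> > 1\<close> the coefficients are absolutely summable, and the
  triangle and the cosine are at most 1 in absolute value. The Weierstrass test therefore allows
  integrating the series of cosines termwise over \<open>[0, l]\<close>.\<close>

lemma osc_coeff_fejer_sums:
  assumes \<sigma>: "\<sigma> > 1" and l: "l > 0"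
  obtains J where "(\<lambda>n. osc_coeff \<sigma> n * fejer l (ln (real n) - y)) sums J"
    "((\<lambda>t. (1 - t / l) * Re (cis (t * y) * (mangoldt_series (Complex \<sigma> t) - zeta_series (Complex \<sigma> t)))) has_integral J) {0..l}"
proof -
  let ?f = "\<lambda>n t. osc_coeff \<sigma> n * ((1 - t / l) * cos (t * (ln (real n) - y)))"
  let ?g = "\<lambda>t. (1 - t / l) * Re (cis (t * y) * (mangoldt_series (Complex \<sigma> t) - zeta_series (Complex \<sigma> t)))"
  have sums: "(\<lambda>n. ?f n t) sums ?g t" for t
    using sums_mult[OF osc_coeff_cos_sums[OF \<sigma>, of t y], of "1 - t / l"] by (simp add: mult_ac)
  have "uniform_limit {0..l} (\<lambda>N t. \<Sum>n<N. ?f n t) (\<lambda>t. \<Sum>n. ?f n t) sequentially"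
  proof (rule Weierstrass_m_test)
    show "norm (?f n t) \<le> \<bar>osc_coeff \<sigma> n\<bar>" if "t \<in> {0..l}" for n t
    proof -
      have "\<bar>1 - t / l\<bar> \<le> 1" using that l by (auto simp: abs_if field_simps)
      then have "\<bar>1 - t / l\<bar> * \<bar>cos (t * (ln (real n) - y))\<bar> \<le> 1 * 1"
        by (intro mult_mono) auto
      then have "\<bar>osc_coeff \<sigma> n\<bar> * (\<bar>1 - t / l\<bar> * \<bar>cos (t * (ln (real n) - y))\<bar>) \<le> \<bar>osc_coeff \<sigma> n\<bar> * 1"
        by (intro mult_left_mono) auto
      then show ?thesis by (simp add: abs_mult)
    qed
  qed (rule summable_osc_coeff[OF \<sigma>])
  also have "(\<lambda>t. \<Sum>n. ?f n t) = ?g"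
  proof
    show "(\<Sum>n. ?f n t) = ?g t" for t using sums[of t] by (rule sums_unique[symmetric])
  qed
  finally have ul: "uniform_limit {0..l} (\<lambda>N t. \<Sum>n<N. ?f n t) ?g sequentially" .
  have ct: "continuous_on {0..l} (\<lambda>t. \<Sum>n<N. ?f n t)" for N
    by (intro continuous_intros) (use l in auto)
  have "\<exists>I J. (\<forall>N. ((\<lambda>t. \<Sum>n<N. ?f n t) has_integral I N) {0..l}) \<and> (?g has_integral J) {0..l} \<and> I \<longlonglongrightarrow> J"
  proof (rule uniform_limit_integral[OF ul ct sequentially_bot])
    fix I J assume "\<And>N. ((\<lambda>t. \<Sum>n<N. ?f n t) has_integral I N) {0..l}" "(?g has_integral J) {0..l}" "I \<longlonglongrightarrow> J"
    then show ?thesis by (intro exI conjI allI)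
  qed
  then obtain I J where IJ: "\<And>N. ((\<lambda>t. \<Sum>n<N. ?f n t) has_integral I N) {0..l}" "(?g has_integral J) {0..l}" "I \<longlonglongrightarrow> J"
    by (elim exE conjE) (rule that, simp_all)
  have "((\<lambda>t. \<Sum>n<N. ?f n t) has_integral (\<Sum>n<N. osc_coeff \<sigma> n * fejer l (ln (real n) - y))) {0..l}" for N
    by (intro has_integral_sum has_integral_mult_right has_integral_fejer l) auto
  then have "I N = (\<Sum>n<N. osc_coeff \<sigma> n * fejer l (ln (real n) - y))" for N
    using IJ(1) has_integral_unique by blast
  then have "I = (\<lambda>N. \<Sum>n<N. osc_coeff \<sigma> n * fejer l (ln (real n) - y))" by blast
  then have "(\<lambda>n. osc_coeff \<sigma> n * fejer l (ln (real n) - y)) sums J"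
    using IJ(3) by (simp add: sums_def)
  then show ?thesis using IJ(2) by (rule that)
qed

text \<open>The Wiener-Ikehara step. The holomorphic extension and its derivative are bounded on the
  compact rectangle with real part in \<open>[1, 2]\<close> and imaginary part in
  \<open>[0, l]\<close>. As this includes the edge \<open>Re s = 1\<close>, the constant does not
  depend on \<open>\<sigma>\<close>. The bound without \<open>y\<close> is used for
  \<open>l = 1\<close> to control blocks; the one with the factor \<open>|y|\<close> gives
  decay.\<close>

lemma osc_coeff_fejer_bound:
  assumes l: "l > 0"
  shows "\<exists>C\<ge>0. \<forall>\<sigma> y. 1 < \<sigma> \<longrightarrow> \<sigma> \<le> 2 \<longrightarrow>
       summable (\<lambda>n. osc_coeff \<sigma> n * fejer l (ln (real n) - y)) \<and>
       \<bar>\<Sum>n. osc_coeff \<sigma> n * fejer l (ln (real n) - y)\<bar> \<le> C \<and>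
       \<bar>\<Sum>n. osc_coeff \<sigma> n * fejer l (ln (real n) - y)\<bar> * \<bar>y\<bar> \<le> C"
proof -
  obtain G U where U: "open U" "{s. Re s \<ge> 1} \<subseteq> U" "G holomorphic_on U"
    and G: "\<And>s. Re s > 1 \<Longrightarrow> G s = mangoldt_series s - zeta_series s"
    using mangoldt_minus_zeta_series_extends by blast
  let ?K = "cbox (Complex 1 0) (Complex 2 l)"
  have KU: "?K \<subseteq> U" using U(2) by (auto simp: in_cbox_complex_iff)
  have cG: "continuous_on U G" using U(3) by (rule holomorphic_on_imp_continuous_on)
  have cG': "continuous_on U (deriv G)" using holomorphic_deriv[OF U(3) U(1)] by (rule holomorphic_on_imp_continuous_on)
  have "bounded (G ` ?K)" "bounded (deriv G ` ?K)"
    by (intro compact_imp_bounded compact_continuous_image compact_cbox continuous_on_subset[OF cG KU] continuous_on_subset[OF cG' KU])+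
  then obtain M0 M1 where M0: "\<And>s. s \<in> ?K \<Longrightarrow> norm (G s) \<le> M0" and M1: "\<And>s. s \<in> ?K \<Longrightarrow> norm (deriv G s) \<le> M1"
    by (auto simp: bounded_iff)
  define M where "M = max 0 (max M0 M1)"
  have M: "M \<ge> 0" "\<And>s. s \<in> ?K \<Longrightarrow> norm (G s) \<le> M" "\<And>s. s \<in> ?K \<Longrightarrow> norm (deriv G s) \<le> M"
    using M0 M1 by (auto simp: M_def le_max_iff_disj)
  \<comment> \<open>The first entry is the trivial bound for the integral. The second comes from
    \<open>oscillatory_integral_bound\<close>, where the derivative of the triangle times
    \<open>G\<close> is at most \<open>M / l + M\<close>.\<close>
  define C where "C = max (M * l) (2 * M + (M / l + M) * l)"
  have b: "\<bar>J\<bar> \<le> C \<and> \<bar>J\<bar> * \<bar>y\<bar> \<le> C" if \<sigma>: "1 < \<sigma>" "\<sigma> \<le> 2"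
    and J: "((\<lambda>t. (1 - t / l) * Re (cis (t * y) * (mangoldt_series (Complex \<sigma> t) - zeta_series (Complex \<sigma> t)))) has_integral J) {0..l}"
    for \<sigma> y J
  proof -
    define f where "f t = of_real (1 - t / l) * G (Complex \<sigma> t)" for t
    define f' where "f' t = of_real (- 1 / l) * G (Complex \<sigma> t) + of_real (1 - t / l) * (\<i> * deriv G (Complex \<sigma> t))" for t
    have K: "Complex \<sigma> t \<in> ?K" if "t \<in> {0..l}" for t using that \<sigma> by (auto simp: in_cbox_complex_iff)
    have c1: "continuous_on {0..l} (\<lambda>t. Complex \<sigma> t)"
      unfolding Complex_eq by (intro continuous_intros)
    have cg: "continuous_on {0..l} (\<lambda>t. G (Complex \<sigma> t))" "continuous_on {0..l} (\<lambda>t. deriv G (Complex \<sigma> t))"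
      by (rule continuous_on_compose2[OF cG c1] continuous_on_compose2[OF cG' c1]; use K KU in blast)+
    have t1: "\<bar>1 - t / l\<bar> \<le> 1" if "t \<in> {0..l}" for t using that l by (auto simp: abs_if field_simps)
    have cf: "continuous_on {0..l} f" unfolding f_def by (intro continuous_intros cg) (use l in auto)
    have cf': "continuous_on {0..l} f'" unfolding f'_def by (intro continuous_intros cg) (use l in auto)
    have nf: "norm (f t) \<le> M" if "t \<in> {0..l}" for t
    proof -
      have "norm (f t) = \<bar>1 - t / l\<bar> * norm (G (Complex \<sigma> t))" by (simp only: f_def norm_mult norm_of_real)
      also have "\<dots> \<le> 1 * M" by (intro mult_mono t1 that M(2) K) auto
      finally show ?thesis by simp
    qed
    have nf': "norm (f' t) \<le> M / l + M" if "t \<in> {0..l}" for t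
    proof -
      have "norm (f' t) \<le> norm (of_real (- 1 / l) * G (Complex \<sigma> t)) + norm (of_real (1 - t / l) * (\<i> * deriv G (Complex \<sigma> t)))"
        unfolding f'_def by (rule norm_triangle_ineq)
      also have "norm (of_real (- 1 / l) * G (Complex \<sigma> t)) = norm (G (Complex \<sigma> t)) / l"
        using l by (simp add: norm_divide)
      also have "\<dots> \<le> M / l" using l by (intro divide_right_mono M(2) K that) auto
      also have "norm (of_real (1 - t / l) * (\<i> * deriv G (Complex \<sigma> t))) = \<bar>1 - t / l\<bar> * norm (deriv G (Complex \<sigma> t))"
        by (simp only: norm_mult norm_of_real norm_ii mult_1)
      also have "\<dots> \<le> 1 * M" by (intro mult_mono t1 that M(3) K) auto
      finally show ?thesis by simp
    qed
    have df: "(f has_vector_derivative f' t) (at t within {0..l})" if t: "t \<in> {0..l}" for t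
    proof -
      have "(G has_field_derivative deriv G (Complex \<sigma> t)) (at (Complex \<sigma> t))"
        using U(1,3) K[OF t] KU by (meson holomorphic_derivI subsetD)
      then have "(G has_field_derivative deriv G (Complex \<sigma> t)) (at (Complex \<sigma> t) within (\<lambda>t. Complex \<sigma> t) ` {0..l})"
        by (rule has_field_derivative_at_within)
      moreover have "((\<lambda>t. Complex \<sigma> t) has_vector_derivative \<i>) (at t within {0..l})"
        by (auto simp: has_vector_derivative_complex_iff intro!: derivative_eq_intros)
      ultimately have "((G \<circ> (\<lambda>t. Complex \<sigma> t)) has_vector_derivative (\<i> * deriv G (Complex \<sigma> t))) (at t within {0..l})"
        by (intro field_vector_diff_chain_within)
      then have 1: "((\<lambda>t. G (Complex \<sigma> t)) has_vector_derivative (\<i> * deriv G (Complex \<sigma> t))) (at t within {0..l})"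
        by (simp add: o_def)
      have 2: "((\<lambda>t. of_real (1 - t / l)) has_vector_derivative (of_real (- 1 / l) :: complex)) (at t within {0..l})"
        using l by (auto simp: has_vector_derivative_complex_iff intro!: derivative_eq_intros)
      show ?thesis unfolding f_def f'_def
        using has_vector_derivative_mult[OF 2 1] by (simp add: add.commute)
    qed
    have ig: "(\<lambda>t. cis (t * y) * f t) integrable_on {0..l}"
      by (intro integrable_continuous_real continuous_intros cf)
    have "((\<lambda>t. Re (cis (t * y) * f t)) has_integral Re (integral {0..l} (\<lambda>t. cis (t * y) * f t))) {0..l}"
      using has_integral_linear[OF integrable_integral[OF ig] bounded_linear_Re] by (simp add: o_def)
    moreover have "(\<lambda>t. (1 - t / l) * Re (cis (t * y) * (mangoldt_series (Complex \<sigma> t) - zeta_series (Complex \<sigma> t))))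
        = (\<lambda>t. Re (cis (t * y) * f t))"
    proof
      fix t
      have "cis (t * y) * f t = of_real (1 - t / l) * (cis (t * y) * (mangoldt_series (Complex \<sigma> t) - zeta_series (Complex \<sigma> t)))"
        using \<sigma> by (simp add: f_def G mult_ac)
      moreover have "Re (of_real r * z) = r * Re z" for r z by simp
      ultimately show "(1 - t / l) * Re (cis (t * y) * (mangoldt_series (Complex \<sigma> t) - zeta_series (Complex \<sigma> t))) = Re (cis (t * y) * f t)"
        by (simp only:)
    qed
    ultimately have "J = Re (integral {0..l} (\<lambda>t. cis (t * y) * f t))"
      using J has_integral_unique by metis
    then have J1: "\<bar>J\<bar> \<le> norm (integral {0..l} (\<lambda>t. cis (t * y) * f t))" by (simp add: abs_Re_le_cmod)
    also have "\<dots> \<le> M * (l - 0)"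
      by (rule integral_bound) (use l nf in \<open>auto simp: norm_mult intro!: continuous_intros cf\<close>)
    finally have 1: "\<bar>J\<bar> \<le> C" by (simp add: C_def)
    have "\<bar>J\<bar> * \<bar>y\<bar> \<le> C"
    proof (cases "y = 0")
      case False
      from J1 have "\<bar>J\<bar> \<le> (2 * M + (M / l + M) * (l - 0)) / \<bar>y\<bar>"
        using oscillatory_integral_bound[OF less_imp_le[OF l] False df cf' nf nf'] by linarith
      then show ?thesis using False by (simp add: pos_le_divide_eq C_def)
    qed (use M(1) l in \<open>auto simp: C_def le_max_iff_disj\<close>)
    with 1 show ?thesis by blast
  qed
  show ?thesis
  proof (intro exI[of _ C] conjI[of "C \<ge> 0"] allI impI)
    show "C \<ge> 0" using M(1) l by (auto simp: C_def le_max_iff_disj)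
    fix \<sigma> y :: real
    assume \<sigma>: "1 < \<sigma>" "\<sigma> \<le> 2"
    show "summable (\<lambda>n. osc_coeff \<sigma> n * fejer l (ln (real n) - y)) \<and>
       \<bar>\<Sum>n. osc_coeff \<sigma> n * fejer l (ln (real n) - y)\<bar> \<le> C \<and>
       \<bar>\<Sum>n. osc_coeff \<sigma> n * fejer l (ln (real n) - y)\<bar> * \<bar>y\<bar> \<le> C"
    proof (rule osc_coeff_fejer_sums[OF \<sigma>(1) l, of y])
      fix J assume J: "(\<lambda>n. osc_coeff \<sigma> n * fejer l (ln (real n) - y)) sums J"
        "((\<lambda>t. (1 - t / l) * Re (cis (t * y) * (mangoldt_series (Complex \<sigma> t) - zeta_series (Complex \<sigma> t)))) has_integral J) {0..l}"
      from b[OF \<sigma> J(2)] sums_summable[OF J(1)] show ?thesis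
        unfolding sums_unique[OF J(1), symmetric] by blast
    qed
  qed
qed

section \<open>Size of the Fejer kernel\<close>

lemma fejer_nonneg: "l > 0 \<Longrightarrow> fejer l u \<ge> 0"
  by (auto simp: fejer_def)

lemma fejer_le_inverse_square: "l > 0 \<Longrightarrow> u \<noteq> 0 \<Longrightarrow> fejer l u \<le> 2 / (l * u\<^sup>2)"
  using cos_ge_minus_one[of "l * u"] by (auto simp: fejer_def intro!: divide_right_mono)

lemma fejer_le:
  assumes l: "l > 0"
  shows "fejer l u \<le> l"
proof -
  have "fejer l u \<le> fejer l 0"
  proof (rule has_integral_le[OF has_integral_fejer[OF l] has_integral_fejer[OF l]])
    fix t assume "t \<in> {0..l}"
    then show "(1 - t / l) * cos (t * u) \<le> (1 - t / l) * cos (t * 0)"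
      using l by (intro mult_left_mono) auto
  qed
  then show ?thesis using l by (simp add: fejer_def)
qed

text \<open>For \<open>t\<close> in \<open>[0, l]\<close> the argument satisfies
  \<open>|t * u| <= 1 < pi / 3\<close>, so the cosine is at least 1/2 and the integral is at least
  half of its value \<open>l / 2\<close> at \<open>u = 0\<close>.\<close>

lemma fejer_ge:
  assumes l: "l > 0" and u: "\<bar>u\<bar> \<le> 1 / l"
  shows "fejer l u \<ge> l / 4"
proof -
  have "fejer l 0 * (1 / 2) \<le> fejer l u"
  proof (rule has_integral_le[OF has_integral_mult_left[OF has_integral_fejer[OF l]] has_integral_fejer[OF l]])
    fix t assume t: "t \<in> {0..l}"
    have "\<bar>t * u\<bar> \<le> l * (1 / l)" unfolding abs_mult using t u by (intro mult_mono) auto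
    then have "\<bar>t * u\<bar> \<le> 1" using l by simp
    then have "cos (pi / 3) \<le> cos \<bar>t * u\<bar>"
      using pi_gt3 by (intro cos_monotone_0_pi_le) auto
    then have "1 / 2 \<le> cos (t * u)" by (simp add: cos_60)
    moreover have "0 \<le> 1 - t / l" using t l by simp
    ultimately have "(1 - t / l) * (1 / 2) \<le> (1 - t / l) * cos (t * u)"
      by (intro mult_left_mono)
    then show "(1 - t / l) * cos (t * 0) * (1 / 2) \<le> (1 - t / l) * cos (t * u)" by simp
  qed
  then show ?thesis by (simp add: fejer_def)
qed

text \<open>Merges the bound by \<open>l\<close> near 0 and the inverse square bound away from 0
  into the shape of weight that \<open>block_weighted_sum\<close> accepts.\<close>

lemma fejer_le_cauchy:
  assumes l: "l > 0"
  shows "fejer l u \<le> (2 * l + 4 / l) / (1 + u\<^sup>2)"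
proof (cases "u\<^sup>2 \<le> 1")
  case True
  have "l * (1 + u\<^sup>2) \<le> l * 2" using True l by (intro mult_left_mono) auto
  then have "l * (1 + u\<^sup>2) \<le> 2 * l + 4 / l" using l by (simp add: add_increasing2)
  then have "l \<le> (2 * l + 4 / l) / (1 + u\<^sup>2)"
    by (simp add: pos_le_divide_eq add_pos_nonneg)
  with fejer_le[OF l, of u] show ?thesis by linarith
next
  case False
  then have u: "u \<noteq> 0" "u\<^sup>2 > 0" by auto
  have "2 / l * (1 + u\<^sup>2) \<le> 2 / l * (2 * u\<^sup>2)" using False l by (intro mult_left_mono) auto
  also have "\<dots> = 4 / l * u\<^sup>2" by simp
  also have "\<dots> \<le> (2 * l + 4 / l) * u\<^sup>2" using l by (intro mult_right_mono) auto
  finally have "2 / l * (1 + u\<^sup>2) \<le> (2 * l + 4 / l) * u\<^sup>2" .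
  then have "2 / (l * u\<^sup>2) \<le> (2 * l + 4 / l) / (1 + u\<^sup>2)"
    using u l by (simp add: divide_simps add_pos_nonneg)
  with fejer_le_inverse_square[OF l u(1)] show ?thesis by linarith
qed

section \<open>Weighted sums over logarithmic blocks\<close>

definition cauchy_const :: real where
  "cauchy_const = 2 * (\<Sum>d::nat. 1 / (1 + real d ^ 2))"

lemma summable_cauchy: "summable (\<lambda>d::nat. 1 / (1 + real d ^ 2))"
proof (rule summable_comparison_test')
  show "summable (\<lambda>d. inverse (real d ^ 2))" by (rule inverse_power_summable) simp
  show "norm (1 / (1 + real d ^ 2)) \<le> inverse (real d ^ 2)" if "d \<ge> 1" for d
    using that by (auto simp: divide_simps add_pos_nonneg)
qed

lemma cauchy_const_nonneg: "cauchy_const \<ge> 0"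
  unfolding cauchy_const_def by (intro mult_nonneg_nonneg suminf_nonneg summable_cauchy) auto

text \<open>The absolute value is injective on the nonnegative and on the negative integers, so each
  half is bounded by the series over the natural numbers; hence the factor 2 in
  \<open>cauchy_const\<close>.\<close>

lemma sum_cauchy_le:
  assumes A: "finite A"
  shows "(\<Sum>k\<in>A. 1 / (1 + (real_of_int k)\<^sup>2)) \<le> cauchy_const"
proof -
  have *: "(\<Sum>k\<in>B. 1 / (1 + (real_of_int k)\<^sup>2)) \<le> (\<Sum>d::nat. 1 / (1 + real d ^ 2))"
    if B: "finite B" "inj_on (\<lambda>k. nat \<bar>k\<bar>) B" for B
  proof -
    have "(\<Sum>k\<in>B. 1 / (1 + (real_of_int k)\<^sup>2)) = (\<Sum>d\<in>(\<lambda>k. nat \<bar>k\<bar>) ` B. 1 / (1 + real d ^ 2))"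
      by (subst sum.reindex[OF B(2)]) simp
    also have "\<dots> \<le> (\<Sum>d. 1 / (1 + real d ^ 2))"
      by (intro sum_le_suminf summable_cauchy) (use B in auto)
    finally show ?thesis .
  qed
  have "(\<Sum>k\<in>A. 1 / (1 + (real_of_int k)\<^sup>2)) = (\<Sum>k\<in>A \<inter> {0..}. 1 / (1 + (real_of_int k)\<^sup>2)) + (\<Sum>k\<in>A \<inter> {..<0}. 1 / (1 + (real_of_int k)\<^sup>2))"
    using A by (subst sum.union_disjoint[symmetric]) (auto intro!: sum.cong)
  also have "\<dots> \<le> (\<Sum>d::nat. 1 / (1 + real d ^ 2)) + (\<Sum>d::nat. 1 / (1 + real d ^ 2))"
    by (intro add_mono *) (use A in \<open>auto simp: inj_on_def\<close>)
  finally show ?thesis by (simp add: cauchy_const_def)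
qed

definition log_block :: "nat \<Rightarrow> nat set" where
  "log_block m = {n. n > 0 \<and> real m \<le> ln (real n) \<and> ln (real n) < real m + 1}"

lemma log_block_subset: "log_block m \<subseteq> {1..nat \<lfloor>exp (real m + 1)\<rfloor>}"
proof
  fix n assume "n \<in> log_block m"
  then have n: "n > 0" "ln (real n) < real m + 1" by (auto simp: log_block_def)
  then have "real n \<le> exp (real m + 1)" by (metis less_imp_le exp_less_cancel_iff exp_ln of_nat_0_less_iff)
  then show "n \<in> {1..nat \<lfloor>exp (real m + 1)\<rfloor>}" using n by (auto simp: le_nat_floor)
qed

lemma finite_log_block: "finite (log_block m)"
  by (rule finite_subset[OF log_block_subset]) auto

text \<open>Controls the terms far from $y$ using only a bound for \<open>c\<close> on each interval
  $m \leq \log n < m + 1$. For $\Lambda(n) / n$ such a bound comes from the kernel with $l = 1$, so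
  that Chebyshev's estimate is not required.\<close>

lemma block_weighted_sum:
  fixes c w :: "nat \<Rightarrow> real"
  assumes c: "\<And>n. c n \<ge> 0" "c 0 = 0"
    and C: "\<And>m. sum c (log_block m) \<le> C"
    and w: "\<And>n. w n \<ge> 0" "\<And>n. n > 0 \<Longrightarrow> c n > 0 \<Longrightarrow> w n \<le> W / (1 + (ln (real n) - y)\<^sup>2)"
    and W: "W \<ge> 0"
  shows "summable (\<lambda>n. c n * w n) \<and> (\<Sum>n. c n * w n) \<le> 4 * C * W * cauchy_const"
proof -
  define j where "j = \<lfloor>y\<rfloor>"
  define \<beta> where "\<beta> n = nat \<lfloor>ln (real n)\<rfloor>" for n
  have C0: "C \<ge> 0" using C[of 0] c(1) by (meson order_trans sum_nonneg)
  have bl: "n \<in> log_block (\<beta> n)" if "n > 0" for n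
  proof -
    have "ln (real n) \<ge> 0" using that by simp
    then have "real (\<beta> n) = of_int \<lfloor>ln (real n)\<rfloor>" by (simp add: \<beta>_def)
    then show ?thesis using that by (simp add: log_block_def)
  qed
  have bl': "\<beta> n = m" if "n \<in> log_block m" for n m
  proof -
    have "\<lfloor>ln (real n)\<rfloor> = int m" using that by (intro floor_unique) (auto simp: log_block_def)
    then show ?thesis by (simp add: \<beta>_def)
  qed
  \<comment> \<open>Replacing \<open>ln n\<close> and \<open>y\<close> by their floors changes their
    difference \<open>u\<close> by at most 1. The new difference \<open>D\<close> has
    \<open>1 + D^2 <= 3 + 2 * u^2 <= 4 * (1 + u^2)\<close>, hence the factor 4, and the weight now
    depends on the block only.\<close>
  define g where "g m = 4 * W * (1 / (1 + (real_of_int (int m - j))\<^sup>2))" for m :: nat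
  have g0: "g m \<ge> 0" for m using W by (auto simp: g_def)
  have wg: "c n * w n \<le> c n * g (\<beta> n)" for n
  proof (cases "n > 0 \<and> c n > 0")
    case True
    then have n: "n > 0" "c n > 0" by auto
    define D where "D = real_of_int (int (\<beta> n) - j)"
    define u where "u = ln (real n) - y"
    have 1: "real (\<beta> n) \<le> ln (real n)" "ln (real n) < real (\<beta> n) + 1" using bl[OF n(1)] by (auto simp: log_block_def)
    have 2: "real_of_int j \<le> y" "y < real_of_int j + 1" by (auto simp: j_def)
    have Du: "\<bar>D - u\<bar> \<le> 1" using 1 2 by (simp add: D_def u_def abs_le_iff)
    have "D\<^sup>2 = (u + (D - u))\<^sup>2" by simp
    also have "\<dots> \<le> 2 * u\<^sup>2 + 2 * (D - u)\<^sup>2"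
      using zero_le_power2[of "u - (D - u)"] by (simp add: power2_eq_square algebra_simps)
    also have "(D - u)\<^sup>2 \<le> 1" using Du by (simp add: abs_square_le_1)
    finally have "1 + D\<^sup>2 \<le> 4 * (1 + u\<^sup>2)" using zero_le_power2[of u] by (smt (verit))
    then have "W * (1 + D\<^sup>2) \<le> W * (4 * (1 + u\<^sup>2))" using W by (rule mult_left_mono)
    then have "W / (1 + u\<^sup>2) \<le> 4 * W * (1 / (1 + D\<^sup>2))"
      by (simp add: divide_simps add_pos_nonneg) (simp add: algebra_simps)
    then have "w n \<le> g (\<beta> n)" using w(2)[OF n] by (simp add: g_def D_def u_def)
    then show ?thesis using c(1) by (rule mult_left_mono)
  next
    case False
    have "c n = 0"
    proof (cases "n = 0")
      case 1: False
      then have "c n \<le> 0" using False by simp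
      then show ?thesis using c(1)[of n] by simp
    qed (simp add: c(2))
    then show ?thesis by simp
  qed
  have part: "(\<Sum>n<N. c n * w n) \<le> 4 * C * W * cauchy_const" for N
  proof -
    have "(\<Sum>n<N. c n * w n) \<le> (\<Sum>n<N. c n * g (\<beta> n))" by (intro sum_mono wg)
    also have "\<dots> = (\<Sum>n\<in>{1..<N}. c n * g (\<beta> n))"
      by (rule sum.mono_neutral_right) (auto simp: c(2) not_le Suc_le_eq)
    also have "\<dots> = (\<Sum>m\<in>\<beta> ` {1..<N}. \<Sum>n\<in>{n \<in> {1..<N}. \<beta> n = m}. c n * g (\<beta> n))"
      by (rule sum.image_gen) auto
    also have "\<dots> \<le> (\<Sum>m\<in>\<beta> ` {1..<N}. C * g m)"
    proof (rule sum_mono)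
      fix m
      have "(\<Sum>n\<in>{n \<in> {1..<N}. \<beta> n = m}. c n * g (\<beta> n)) = (\<Sum>n\<in>{n \<in> {1..<N}. \<beta> n = m}. c n) * g m"
        by (simp add: sum_distrib_right)
      also have "(\<Sum>n\<in>{n \<in> {1..<N}. \<beta> n = m}. c n) \<le> sum c (log_block m)"
        by (rule sum_mono2[OF finite_log_block]) (use bl c in auto)
      also have "\<dots> \<le> C" by (rule C)
      finally show "(\<Sum>n\<in>{n \<in> {1..<N}. \<beta> n = m}. c n * g (\<beta> n)) \<le> C * g m"
        using g0 by (simp add: mult_right_mono)
    qed
    also have "\<dots> = 4 * C * W * (\<Sum>m\<in>\<beta> ` {1..<N}. 1 / (1 + (real_of_int (int m - j))\<^sup>2))"
      by (simp add: g_def sum_distrib_left mult_ac)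
    also have "(\<Sum>m\<in>\<beta> ` {1..<N}. 1 / (1 + (real_of_int (int m - j))\<^sup>2)) =
        (\<Sum>k\<in>(\<lambda>m. int m - j) ` (\<beta> ` {1..<N}). 1 / (1 + (real_of_int k)\<^sup>2))"
      by (subst sum.reindex) (auto simp: inj_on_def)
    also have "4 * C * W * \<dots> \<le> 4 * C * W * cauchy_const"
      using C0 W by (intro mult_left_mono sum_cauchy_le) auto
    finally show ?thesis .
  qed
  have nn: "c n * w n \<ge> 0" for n using c w by simp
  have "summable (\<lambda>n. c n * w n)" using nn part by (rule summableI_nonneg_bounded)
  moreover from this have "(\<Sum>n. c n * w n) \<le> 4 * C * W * cauchy_const"
    by (rule suminf_le_const) (rule part)
  ultimately show ?thesis by blast
qed

section \<open>Primes in short intervals\<close>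

text \<open>The block has at most \<open>exp (m + 1)\<close> elements, each contributing at most
  \<open>exp (- m)\<close>.\<close>

lemma sum_inverse_log_block_le: "(\<Sum>n\<in>log_block m. 1 / real n) \<le> 3"
proof -
  have "(\<Sum>n\<in>log_block m. 1 / real n) \<le> (\<Sum>n\<in>log_block m. exp (- real m))"
  proof (rule sum_mono)
    fix n assume "n \<in> log_block m"
    then have n: "n > 0" "real m \<le> ln (real n)" by (auto simp: log_block_def)
    then have "exp (real m) \<le> real n" by (simp add: ln_ge_iff)
    then show "1 / real n \<le> exp (- real m)" using n by (simp add: exp_minus divide_simps)
  qed
  also have "\<dots> = real (card (log_block m)) * exp (- real m)" by simp
  also have "card (log_block m) \<le> card {1..nat \<lfloor>exp (real m + 1)\<rfloor>}"
    by (intro card_mono log_block_subset) auto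
  then have "card (log_block m) \<le> nat \<lfloor>exp (real m + 1)\<rfloor>" by simp
  then have "real (card (log_block m)) \<le> real (nat \<lfloor>exp (real m + 1)\<rfloor>)" by (rule of_nat_mono)
  also have "\<dots> \<le> exp (real m + 1)" by simp
  finally have "(\<Sum>n\<in>log_block m. 1 / real n) \<le> exp (real m + 1) * exp (- real m)"
    by (simp add: mult_right_mono)
  also have "\<dots> = exp 1" by (simp flip: exp_add)
  also have "\<dots> \<le> 3" by (rule exp_le)
  finally show ?thesis by simp
qed

lemma powr_le_inverse: "n > 0 \<Longrightarrow> \<sigma> \<ge> 1 \<Longrightarrow> real n powr (- \<sigma>) \<le> 1 / real n"
  using powr_mono[of "- \<sigma>" "- 1" "real n"] by (simp add: powr_minus field_simps)

lemma zeta_fejer_upper: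
  assumes "l > 0" "\<sigma> \<ge> 1"
  shows "summable (\<lambda>n. real n powr (- \<sigma>) * fejer l (ln (real n) - y)) \<and>
    (\<Sum>n. real n powr (- \<sigma>) * fejer l (ln (real n) - y)) \<le> 4 * 3 * (2 * l + 4 / l) * cauchy_const"
proof (rule block_weighted_sum)
  show "(\<Sum>n\<in>log_block m. real n powr (- \<sigma>)) \<le> 3" for m
  proof -
    have "(\<Sum>n\<in>log_block m. real n powr (- \<sigma>)) \<le> (\<Sum>n\<in>log_block m. 1 / real n)"
      by (intro sum_mono powr_le_inverse assms) (auto simp: log_block_def)
    also have "\<dots> \<le> 3" by (rule sum_inverse_log_block_le)
    finally show ?thesis .
  qed
qed (use assms fejer_nonneg fejer_le_cauchy in auto)

text \<open>Only integers with \<open>|ln n - y| <= 1 / l\<close> are counted. There are at least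
  \<open>exp y / (2 * l)\<close> of them, the kernel there is at least \<open>l / 4\<close>, and
  \<open>n powr (- \<sigma>)\<close> is at least \<open>exp (- y) / 6\<close>; the product is 1/48,
  independent of \<open>l\<close> and \<open>y\<close>. The condition \<open>y >= ln l\<close>
  absorbs the loss from rounding the endpoints, and the upper bound on \<open>\<sigma>\<close>
  limits the loss against \<open>1 / n\<close> to a factor \<open>exp (- 1 / 2)\<close>.\<close>

lemma zeta_fejer_lower:
  assumes l: "l \<ge> 1" and y: "y \<ge> ln l" and \<sigma>: "1 \<le> \<sigma>" "\<sigma> \<le> 1 + 1 / (2 * (y + 1))"
  shows "(\<Sum>n. real n powr (- \<sigma>) * fejer l (ln (real n) - y)) \<ge> 1 / 48"
proof -
  define a where "a = exp (y - 1 / l)"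
  define b where "b = exp (y + 1 / l)"
  define A where "A = {nat \<lfloor>a\<rfloor> + 1..nat \<lfloor>b\<rfloor>}"
  have y0: "y \<ge> 0" using l y ln_ge_zero[OF l] by linarith
  have ab: "0 < a" "a \<le> b" using l by (auto simp: a_def b_def)
  have l0: "l > 0" using l by simp
  have l1: "1 / l \<le> 1" using l by simp
  have tm: "real n powr (- \<sigma>) * fejer l (ln (real n) - y) \<ge> exp (- y) / 6 * (l / 4)" if "n \<in> A" for n
  proof -
    have n: "n > 0" using that by (simp add: A_def)
    have "a < real n" using that ab by (simp add: A_def) linarith
    moreover have "real n \<le> b" using that ab by (simp add: A_def) linarith
    ultimately have "ln a \<le> ln (real n)" "ln (real n) \<le> ln b"
      using n ab by auto
    then have ln: "y - 1 / l \<le> ln (real n)" "ln (real n) \<le> y + 1 / l"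
      by (simp_all add: a_def b_def)
    have f: "fejer l (ln (real n) - y) \<ge> l / 4" using ln l0 by (intro fejer_ge) (auto simp: abs_le_iff)
    have "(\<sigma> - 1) * ln (real n) \<le> 1 / (2 * (y + 1)) * (y + 1)"
      using \<sigma> ln l1 y0 n by (intro mult_mono) auto
    also have "\<dots> = 1 / 2" using y0 by (simp add: field_simps)
    finally have s: "(\<sigma> - 1) * ln (real n) \<le> 1 / 2" .
    have "exp (- y) / 6 = exp (- y) * (1 / 3) * (1 / 2)" by simp
    also have "\<dots> \<le> exp (- y) * exp (- 1) * exp (- (1 / 2))"
      using exp_le exp_ge_add_one_self[of "- (1 / 2)"] by (intro mult_mono) (auto simp: exp_minus divide_simps)
    also have "\<dots> = exp (- y - 1 - 1 / 2)" by (simp flip: exp_add)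
    also have "\<dots> \<le> exp (- ln (real n) - (\<sigma> - 1) * ln (real n))"
      using ln l1 s by simp
    also have "\<dots> = real n powr (- \<sigma>)" using n by (simp add: powr_def algebra_simps)
    finally show ?thesis using f l by (intro mult_mono) auto
  qed
  have card: "real (card A) \<ge> exp y / (2 * l)"
  proof -
    have "nat \<lfloor>a\<rfloor> \<le> nat \<lfloor>b\<rfloor>" using ab by (intro nat_mono floor_mono)
    then have "real (card A) = real (nat \<lfloor>b\<rfloor>) - real (nat \<lfloor>a\<rfloor>)" by (simp add: A_def of_nat_diff)
    also have "\<dots> \<ge> b - a - 1" using ab by linarith
    finally have "real (card A) \<ge> b - a - 1" .
    moreover have "b - a \<ge> exp y * (3 / (2 * l))"
    proof -
      have "b - a = exp y * (exp (1 / l) - exp (- (1 / l)))"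
        by (simp add: a_def b_def exp_diff exp_add exp_minus field_simps)
      also have "exp (1 / l) - exp (- (1 / l)) \<ge> 3 / (2 * l)"
      proof -
        define x where "x = 1 / l"
        have x: "0 \<le> x" "x \<le> 1" using l0 l1 by (auto simp: x_def)
        have "exp (- x) \<le> 1 / (1 + x)"
          using exp_ge_add_one_self[of x] x by (simp add: exp_minus divide_simps)
        also have "\<dots> \<le> 1 - x / 2" using x mult_left_mono[of x 1 x] by (simp add: field_simps)
        finally have "exp x - exp (- x) \<ge> 3 / 2 * x" using exp_ge_add_one_self[of x] by linarith
        then show ?thesis by (simp add: x_def)
      qed
      then have "exp y * (exp (1 / l) - exp (- (1 / l))) \<ge> exp y * (3 / (2 * l))" by (intro mult_left_mono) auto
      finally show ?thesis .
    qed
    moreover have "exp y / l \<ge> 1"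
    proof -
      have "l = exp (ln l)" using l0 by simp
      also have "\<dots> \<le> exp y" using y by simp
      finally show ?thesis using l0 by simp
    qed
    moreover have "exp y * (3 / (2 * l)) = 3 / 2 * (exp y / l)" by simp
    moreover have "exp y / (2 * l) = 1 / 2 * (exp y / l)" by simp
    ultimately show ?thesis by linarith
  qed
  have "1 / 48 = exp y / (2 * l) * (exp (- y) / 6 * (l / 4))" using l0 by (simp add: exp_minus)
  also have "\<dots> \<le> real (card A) * (exp (- y) / 6 * (l / 4))" using card l0 by (intro mult_right_mono) auto
  also have "\<dots> = (\<Sum>n\<in>A. exp (- y) / 6 * (l / 4))" by simp
  also have "\<dots> \<le> (\<Sum>n\<in>A. real n powr (- \<sigma>) * fejer l (ln (real n) - y))" by (intro sum_mono tm)
  also have "\<dots> \<le> (\<Sum>n. real n powr (- \<sigma>) * fejer l (ln (real n) - y))"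
    using zeta_fejer_upper[OF l0 \<sigma>(1), of y] fejer_nonneg[OF l0]
    by (intro sum_le_suminf) (auto simp: A_def)
  finally show ?thesis .
qed

lemma mangoldt_fejer_eq:
  assumes l: "l > 0" and \<sigma>: "\<sigma> \<ge> 1"
    and s: "summable (\<lambda>n. osc_coeff \<sigma> n * fejer l (ln (real n) - y))"
  shows "(\<lambda>n. mangoldt n * real n powr (- \<sigma>) * fejer l (ln (real n) - y)) sums
    ((\<Sum>n. osc_coeff \<sigma> n * fejer l (ln (real n) - y)) + (\<Sum>n. real n powr (- \<sigma>) * fejer l (ln (real n) - y)))"
proof -
  have "(\<lambda>n. osc_coeff \<sigma> n * fejer l (ln (real n) - y) + real n powr (- \<sigma>) * fejer l (ln (real n) - y)) sums
    ((\<Sum>n. osc_coeff \<sigma> n * fejer l (ln (real n) - y)) + (\<Sum>n. real n powr (- \<sigma>) * fejer l (ln (real n) - y)))"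
    using zeta_fejer_upper[OF l \<sigma>, of y] by (intro sums_add summable_sums s) auto
  then show ?thesis by (simp add: osc_coeff_def algebra_simps)
qed

text \<open>On the block \<open>m\<close> the kernel with \<open>l = 1\<close> centred at
  \<open>m\<close> is at least 1/4. All terms are nonnegative, so the block sum is at most 4 times
  the full smoothed sum, which is bounded uniformly in \<open>m\<close> and in
  \<open>\<sigma>\<close> in \<open>(1, 2]\<close>. The block is finite, so \<open>\<sigma>\<close>
  may tend to 1.\<close>

lemma sum_mangoldt_log_block_bounded:
  "\<exists>C\<ge>0. \<forall>m. (\<Sum>n\<in>log_block m. mangoldt n / real n) \<le> C"
proof -
  obtain C1 where C1: "C1 \<ge> 0" "\<And>\<sigma> y. 1 < \<sigma> \<Longrightarrow> \<sigma> \<le> 2 \<Longrightarrow>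
       summable (\<lambda>n. osc_coeff \<sigma> n * fejer 1 (ln (real n) - y)) \<and>
       \<bar>\<Sum>n. osc_coeff \<sigma> n * fejer 1 (ln (real n) - y)\<bar> \<le> C1"
    using osc_coeff_fejer_bound[of 1] by auto
  define C where "C = 4 * (C1 + 4 * 3 * (2 * 1 + 4 / 1) * cauchy_const)"
  have *: "(\<Sum>n\<in>log_block m. mangoldt n * real n powr (- \<sigma>)) \<le> C" if \<sigma>: "1 < \<sigma>" "\<sigma> \<le> 2" for m \<sigma>
  proof -
    define y where "y = real m"
    let ?F = "\<lambda>n. mangoldt n * real n powr (- \<sigma>) * fejer 1 (ln (real n) - y)"
    have F0: "?F n \<ge> 0" for n using mangoldt_nonneg[of n] fejer_nonneg[of 1] by auto
    have s: "?F sums ((\<Sum>n. osc_coeff \<sigma> n * fejer 1 (ln (real n) - y)) + (\<Sum>n. real n powr (- \<sigma>) * fejer 1 (ln (real n) - y)))"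
      by (rule mangoldt_fejer_eq) (use \<sigma> C1(2)[OF \<sigma>] in auto)
    have "(\<Sum>n\<in>log_block m. mangoldt n * real n powr (- \<sigma>)) = 4 * (\<Sum>n\<in>log_block m. mangoldt n * real n powr (- \<sigma>) * (1 / 4))"
      by (simp add: sum_distrib_left)
    also have "(\<Sum>n\<in>log_block m. mangoldt n * real n powr (- \<sigma>) * (1 / 4)) \<le> (\<Sum>n\<in>log_block m. ?F n)"
    proof (rule sum_mono)
      fix n assume "n \<in> log_block m"
      then have "fejer 1 (ln (real n) - y) \<ge> 1 / 4"
        by (intro fejer_ge) (auto simp: log_block_def y_def)
      then show "mangoldt n * real n powr (- \<sigma>) * (1 / 4) \<le> ?F n"
        using mangoldt_nonneg[of n] by (intro mult_left_mono) auto
    qed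
    also have "(\<Sum>n\<in>log_block m. ?F n) \<le> (\<Sum>n. ?F n)"
      using F0 by (intro sum_le_suminf sums_summable[OF s] finite_log_block) auto
    also have "\<dots> = (\<Sum>n. osc_coeff \<sigma> n * fejer 1 (ln (real n) - y)) + (\<Sum>n. real n powr (- \<sigma>) * fejer 1 (ln (real n) - y))"
      using s by (rule sums_unique[symmetric])
    also have "\<dots> \<le> C1 + 4 * 3 * (2 * 1 + 4 / 1) * cauchy_const"
      using C1(2)[OF \<sigma>, of y] zeta_fejer_upper[of 1 \<sigma> y] \<sigma> by (intro add_mono) auto
    finally show ?thesis by (simp add: C_def)
  qed
  have "(\<Sum>n\<in>log_block m. mangoldt n / real n) \<le> C" for m
  proof -
    have "((\<lambda>\<sigma>. \<Sum>n\<in>log_block m. mangoldt n * real n powr (- \<sigma>)) \<longlongrightarrow> (\<Sum>n\<in>log_block m. mangoldt n * real n powr (- 1))) (at_right 1)"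
      by (intro tendsto_sum tendsto_mult tendsto_const tendsto_powr tendsto_minus tendsto_ident_at) (auto simp: log_block_def)
    moreover have "\<forall>\<^sub>F \<sigma> in at_right 1. (\<Sum>n\<in>log_block m. mangoldt n * real n powr (- \<sigma>)) \<le> C"
      unfolding eventually_at_right_field by (intro exI[of _ 2]) (auto intro!: *)
    ultimately have "(\<Sum>n\<in>log_block m. mangoldt n * real n powr (- 1)) \<le> C"
      by (rule tendsto_upperbound) auto
    then show ?thesis by (simp add: powr_minus divide_inverse)
  qed
  moreover have "C \<ge> 0" using C1(1) cauchy_const_nonneg by (auto simp: C_def)
  ultimately show ?thesis by blast
qed

text \<open>Only the powers \<open>p ^ k\<close> with \<open>k >= 2\<close> contribute. Their
  geometric sums are at most \<open>2 / p^2\<close>, leaving twice the convergent series of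
  \<open>ln p / p^2\<close>. This lets proper prime powers be neglected near
  \<open>y\<close>.\<close>

lemma summable_mangoldt_nonprime:
  "summable (\<lambda>n. if prime n then 0 else mangoldt n / real n)"
proof (rule summableI_nonneg_bounded)
  define K where "K = (\<Sum>n. 2 * (ln (real n) * real n powr (- 2)))"
  fix N :: nat
  let ?P = "{p. prime p \<and> p < N}"
  have "(\<Sum>n<N. if prime n then 0 else mangoldt n / real n) = (\<Sum>n | n < N \<and> primepow n \<and> \<not> prime n. mangoldt n / real n)"
    by (rule sum.mono_neutral_cong_right) (auto simp: mangoldt_def)
  also have "\<dots> \<le> (\<Sum>n\<in>(\<lambda>(p, k). p ^ k) ` (?P \<times> {2..N}). mangoldt n / real n)"
  proof (rule sum_mono2)
    \<comment> \<open>Exponents up to \<open>N\<close> suffice because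
      \<open>k < p ^ k < N\<close>.\<close>
    show "{n. n < N \<and> primepow n \<and> \<not> prime n} \<subseteq> (\<lambda>(p, k). p ^ k) ` (?P \<times> {2..N})"
    proof
      fix n assume "n \<in> {n. n < N \<and> primepow n \<and> \<not> prime n}"
      then have n: "n < N" "primepow n" "\<not> prime n" by auto
      from n(2) obtain p k where pk: "prime p" "k > 0" "n = p ^ k" by (auto simp: primepow_def)
      have "k \<noteq> 1" using n(3) pk by auto
      then have k: "k \<ge> 2" using pk(2) by linarith
      have p2: "p \<ge> 2" using pk(1) by (rule prime_ge_2_nat)
      have "p ^ 1 \<le> p ^ k" using p2 pk(2) by (intro power_increasing) auto
      moreover have "k < p ^ k" using p2 power_gt_expt[of p k] by simp
      ultimately show "n \<in> (\<lambda>(p, k). p ^ k) ` (?P \<times> {2..N})"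
        using pk k n(1) by (intro image_eqI[of _ _ "(p, k)"]) auto
    qed
  qed (auto simp: mangoldt_nonneg)
  also have "\<dots> \<le> (\<Sum>x\<in>?P \<times> {2..N}. mangoldt (case x of (p, k) \<Rightarrow> p ^ k) / real (case x of (p, k) \<Rightarrow> p ^ k))"
    using sum_image_le[of "?P \<times> {2..N}" "\<lambda>n. mangoldt n / real n" "\<lambda>(p, k). p ^ k"] by (simp add: o_def mangoldt_nonneg)
  also have "\<dots> = (\<Sum>p\<in>?P. \<Sum>k\<in>{2..N}. ln (real p) * (1 / real p) ^ k)"
    by (subst sum.cartesian_product) (auto intro!: sum.cong simp: power_one_over field_simps)
  also have "\<dots> \<le> (\<Sum>p\<in>?P. 2 * (ln (real p) * real p powr (- 2)))"
  proof (rule sum_mono)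
    fix p assume "p \<in> ?P"
    then have p: "real p \<ge> 2" using prime_ge_2_nat[of p] by auto
    define x where "x = 1 / real p"
    have x: "0 < x" "x \<le> 1 / 2" using p by (auto simp: x_def field_simps)
    have "(\<Sum>k\<in>{2..N}. x ^ k) \<le> 2 * x ^ 2"
    proof -
      have "(\<Sum>k\<in>{2..N}. x ^ k) \<le> (\<Sum>k\<in>{2..N+2}. x ^ k)" using x by (intro sum_mono2) auto
      also have "\<dots> = x ^ 2 * (\<Sum>k\<le>N. x ^ k)"
        unfolding sum_distrib_left power_add[symmetric]
        by (rule sum.reindex_bij_witness[of _ "\<lambda>k. k + 2" "\<lambda>k. k - 2"]) (auto simp del: add_2_eq_Suc add_2_eq_Suc')
      also have "(\<Sum>k\<le>N. x ^ k) \<le> (\<Sum>k. x ^ k)" using x by (intro sum_le_suminf summable_geometric) auto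
      also have "(\<Sum>k. x ^ k) = 1 / (1 - x)" using x by (intro suminf_geometric) auto
      also have "\<dots> \<le> 2" using x by (simp add: field_simps)
      finally show ?thesis using x by (simp add: mult.commute)
    qed
    then have "ln (real p) * (\<Sum>k\<in>{2..N}. x ^ k) \<le> ln (real p) * (2 * x ^ 2)"
      using p by (intro mult_left_mono) auto
    also have "\<dots> = 2 * (ln (real p) * real p powr (- 2))"
      using p by (simp add: x_def powr_minus divide_inverse power_inverse)
    finally show "(\<Sum>k\<in>{2..N}. ln (real p) * (1 / real p) ^ k) \<le> 2 * (ln (real p) * real p powr (- 2))"
      by (simp add: x_def sum_distrib_left)
  qed
  also have "\<dots> \<le> K" unfolding K_def
  proof (rule sum_le_suminf)
    show "summable (\<lambda>n. 2 * (ln (real n) * real n powr (- 2)))" by (intro summable_mult summable_ln_powr) simp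
    show "0 \<le> 2 * (ln (real n) * real n powr (- 2))" for n by (cases "n = 0") auto
  qed auto
  finally show "(\<Sum>n<N. if prime n then 0 else mangoldt n / real n) \<le> K" .
qed (auto simp: mangoldt_nonneg)

text \<open>Without a prime near \<open>y\<close>, the sum over integers, at least 1/48 = 4/192,
  would be bounded by three errors of at most 1/192 each: the terms far from \<open>y\<close>, the
  proper prime powers near \<open>y\<close>, and the oscillating sum.\<close>

lemma eventually_prime_near_log:
  assumes \<eta>: "\<eta> > 0"
  shows "\<forall>\<^sub>F y in at_top. \<exists>p. prime p \<and> \<bar>ln (real p) - y\<bar> \<le> \<eta>"
proof -
  obtain C where C: "C \<ge> 0" "\<And>m. (\<Sum>n\<in>log_block m. mangoldt n / real n) \<le> C"
    using sum_mangoldt_log_block_bounded by blast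
  define D where "D = C * cauchy_const * (1 + 1 / \<eta>\<^sup>2)"
  have D: "D \<ge> 0" using C(1) cauchy_const_nonneg by (simp add: D_def)
  \<comment> \<open>The far terms are bounded by \<open>8 * D / l\<close>, and 1536 = 8 *
    192.\<close>
  define l where "l = 1 + 1536 * D"
  have l: "l \<ge> 1" "l > 0" using D by (auto simp: l_def)
  \<comment> \<open>For \<open>|u| > \<eta>\<close> one has
    \<open>1 + u^2 <= (1 + 1 / \<eta>^2) * u^2\<close>, which turns the inverse square bound for the
    kernel into \<open>W / (1 + u^2)\<close>.\<close>
  define W where "W = 2 / l * (1 + 1 / \<eta>\<^sup>2)"
  have W: "W \<ge> 0" using l by (simp add: W_def)
  have WC: "4 * C * W * cauchy_const \<le> 1 / 192"
  proof -
    have "4 * C * W * cauchy_const = 8 * D / l" by (simp add: W_def D_def mult_ac)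
    also have "\<dots> \<le> 1 / 192" using D by (simp add: l_def divide_simps)
    finally show ?thesis .
  qed
  obtain K where K0: "K \<ge> 0" and K': "\<forall>\<sigma> y. 1 < \<sigma> \<longrightarrow> \<sigma> \<le> 2 \<longrightarrow>
       summable (\<lambda>n. osc_coeff \<sigma> n * fejer l (ln (real n) - y)) \<and>
       \<bar>\<Sum>n. osc_coeff \<sigma> n * fejer l (ln (real n) - y)\<bar> \<le> K \<and>
       \<bar>\<Sum>n. osc_coeff \<sigma> n * fejer l (ln (real n) - y)\<bar> * \<bar>y\<bar> \<le> K"
    using osc_coeff_fejer_bound[OF l(2)] by (elim exE conjE) (rule that)
  note K = K'[rule_format]
  define h where "h n = (if prime n then 0 else mangoldt n / real n)" for n
  have h0: "h n \<ge> 0" for n by (auto simp: h_def mangoldt_nonneg)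
  have hs: "summable h" unfolding h_def by (rule summable_mangoldt_nonprime)
  \<comment> \<open>The kernel is at most \<open>l\<close>, so this tail of the proper prime powers
    contributes at most 1/192.\<close>
  obtain N where N: "norm (\<Sum>i. h (i + N)) < 1 / (192 * l)"
    using suminf_exist_split[of "1 / (192 * l)", OF _ hs] l by auto
  define hN where "hN n = (if n \<ge> N then h n else 0)" for n
  have hN: "hN sums (\<Sum>i. h (i + N))"
  proof -
    have "(\<lambda>i. h (i + N)) sums (\<Sum>i. h (i + N))"
      by (intro summable_sums summable_ignore_initial_segment hs)
    then have "(\<lambda>i. hN (i + N)) sums (\<Sum>i. h (i + N))" by (simp add: hN_def)
    then have "hN sums ((\<Sum>i. h (i + N)) + (\<Sum>i<N. hN i))" by (subst (asm) sums_iff_shift)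
    then show ?thesis by (simp add: hN_def)
  qed
  \<comment> \<open>The conditions on \<open>y\<close> serve, in turn,
    \<open>zeta_fejer_lower\<close>, the bound \<open>K / y <= 1 / 192\<close> for the oscillating
    sum, the division by \<open>y\<close>, and the claim that every positive \<open>n\<close> with
    \<open>|ln n - y| <= \<eta>\<close> is at least \<open>N\<close>.\<close>
  have main: "\<exists>p. prime p \<and> \<bar>ln (real p) - y\<bar> \<le> \<eta>"
    if y: "y \<ge> ln l" "y \<ge> 192 * K" "y \<ge> 1" "y \<ge> ln (real N) + \<eta>" for y
  proof (rule ccontr)
    assume "\<not> ?thesis"
    then have np: "\<not> prime n" if "\<bar>ln (real n) - y\<bar> \<le> \<eta>" for n using that by blast
    \<comment> \<open>The largest value \<open>zeta_fejer_lower\<close> admits. It may depend on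
      \<open>y\<close> because \<open>K\<close> is uniform in \<open>\<sigma>\<close>.\<close>
    define \<sigma> where "\<sigma> = 1 + 1 / (2 * (y + 1))"
    have \<sigma>: "1 < \<sigma>" "\<sigma> \<le> 2" using y by (auto simp: \<sigma>_def field_simps)
    let ?w = "\<lambda>n. fejer l (ln (real n) - y)"
    define c where "c n = (if \<bar>ln (real n) - y\<bar> \<le> \<eta> then 0 else mangoldt n * real n powr (- \<sigma>))" for n
    have c0: "c n \<ge> 0" for n by (simp add: c_def mangoldt_nonneg)
    have cb: "sum c (log_block m) \<le> C" for m
    proof -
      have "sum c (log_block m) \<le> (\<Sum>n\<in>log_block m. mangoldt n / real n)"
      proof (rule sum_mono)
        fix n assume "n \<in> log_block m"
        then have "n > 0" by (simp add: log_block_def)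
        then have "mangoldt n * real n powr (- \<sigma>) \<le> mangoldt n * (1 / real n)"
          using \<sigma> by (intro mult_left_mono powr_le_inverse) (auto simp: mangoldt_nonneg)
        then show "c n \<le> mangoldt n / real n" by (simp add: c_def mangoldt_nonneg)
      qed
      also have "\<dots> \<le> C" by (rule C(2))
      finally show ?thesis .
    qed
    have far: "summable (\<lambda>n. c n * ?w n) \<and> (\<Sum>n. c n * ?w n) \<le> 4 * C * W * cauchy_const"
    proof (rule block_weighted_sum[OF c0 _ cb _ _ W])
      show "?w n \<le> W / (1 + (ln (real n) - y)\<^sup>2)" if "c n > 0" for n
      proof -
        define u where "u = ln (real n) - y"
        have u: "\<eta> < \<bar>u\<bar>" using that by (auto simp: c_def u_def split: if_splits)
        then have u0: "u \<noteq> 0" "u\<^sup>2 > 0" using \<eta> by auto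
        have "\<eta>\<^sup>2 \<le> u\<^sup>2" using u \<eta> by (metis abs_le_square_iff abs_of_pos less_imp_le)
        then have "1 + u\<^sup>2 \<le> (1 + 1 / \<eta>\<^sup>2) * u\<^sup>2" using \<eta> by (simp add: field_simps)
        then have "2 / l * (1 + u\<^sup>2) \<le> 2 / l * ((1 + 1 / \<eta>\<^sup>2) * u\<^sup>2)" using l by (intro mult_left_mono) auto
        then have "2 / l * (1 + u\<^sup>2) \<le> W * u\<^sup>2" by (simp only: W_def mult.assoc)
        then have "2 / (l * u\<^sup>2) \<le> W / (1 + u\<^sup>2)"
          using u0 l by (simp add: divide_simps add_pos_nonneg mult_ac)
        with fejer_le_inverse_square[OF l(2) u0(1)] show ?thesis by (simp add: u_def)
      qed
    qed (use fejer_nonneg[OF l(2)] in \<open>auto simp: c_def\<close>)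
    let ?F = "\<lambda>n. mangoldt n * real n powr (- \<sigma>) * ?w n"
    have Fle: "?F n \<le> c n * ?w n + l * hN n" for n
    proof (cases "n = 0 \<or> \<bar>ln (real n) - y\<bar> > \<eta>")
      case True
      then show ?thesis using h0[of n] l by (auto simp: c_def hN_def)
    next
      case False
      then have n: "n > 0" "\<bar>ln (real n) - y\<bar> \<le> \<eta>" by auto
      have nN: "n \<ge> N"
      proof (cases "N = 0")
        case False
        have "ln (real N) \<le> ln (real n)" using n y by linarith
        then show ?thesis using False n by simp
      qed auto
      have "?F n \<le> mangoldt n * (1 / real n) * l"
        using \<sigma> n l by (intro mult_mono mult_nonneg_nonneg mangoldt_nonneg fejer_le fejer_nonneg powr_le_inverse) auto
      also have "\<dots> = l * hN n" using np[OF n(2)] nN by (simp add: hN_def h_def)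
      finally show ?thesis using n by (simp add: c_def)
    qed
    have osc: "\<bar>\<Sum>n. osc_coeff \<sigma> n * ?w n\<bar> \<le> 1 / 192"
    proof -
      have "\<bar>\<Sum>n. osc_coeff \<sigma> n * ?w n\<bar> * y \<le> K" using K[OF \<sigma>, of y] y by auto
      also have "\<dots> \<le> 1 / 192 * y" using y by simp
      finally show ?thesis using y by (simp only: mult_le_cancel_right)
    qed
    have Fs: "?F sums ((\<Sum>n. osc_coeff \<sigma> n * ?w n) + (\<Sum>n. real n powr (- \<sigma>) * ?w n))"
      by (rule mangoldt_fejer_eq) (use l \<sigma> K[OF \<sigma>] in auto)
    have "(\<lambda>n. c n * ?w n + l * hN n) sums ((\<Sum>n. c n * ?w n) + l * (\<Sum>i. h (i + N)))"
      using far by (intro sums_add sums_mult hN summable_sums) auto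
    from sums_le[OF Fle Fs this]
    have "(\<Sum>n. osc_coeff \<sigma> n * ?w n) + (\<Sum>n. real n powr (- \<sigma>) * ?w n) \<le> (\<Sum>n. c n * ?w n) + l * (\<Sum>i. h (i + N))" .
    moreover have "1 / 48 \<le> (\<Sum>n. real n powr (- \<sigma>) * ?w n)"
      by (rule zeta_fejer_lower) (use l y \<sigma> in \<open>auto simp: \<sigma>_def\<close>)
    moreover have "(\<Sum>n. c n * ?w n) \<le> 1 / 192" using far WC by linarith
    moreover have "l * (\<Sum>i. h (i + N)) \<le> 1 / 192"
    proof -
      have "(\<Sum>i. h (i + N)) \<le> 1 / (192 * l)" using N by auto
      then have "l * (\<Sum>i. h (i + N)) \<le> l * (1 / (192 * l))" using l by (intro mult_left_mono) auto
      then show ?thesis using l by simp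
    qed
    ultimately show False using osc by (simp add: abs_le_iff)
  qed
  show ?thesis
    using eventually_ge_at_top[of "ln l"] eventually_ge_at_top[of "192 * K"] eventually_ge_at_top[of 1]
      eventually_ge_at_top[of "ln (real N) + \<eta>"]
    by eventually_elim (rule main)
qed

theorem eventually_prime_between:
  assumes "\<epsilon> > 0"
  shows "\<forall>\<^sub>F n in sequentially. \<exists>p. prime p \<and> n < p \<and> real p \<le> (1 + \<epsilon>) * real n"
proof -
  \<comment> \<open>Centring at \<open>ln n + 2 * \<eta>\<close> with radius \<open>\<eta>\<close>
    places the prime between \<open>exp \<eta> * n\<close> and
    \<open>exp (3 * \<eta>) * n = (1 + \<epsilon>) * n\<close>, which also makes
    \<open>n < p\<close> strict.\<close>
  define \<eta> where "\<eta> = ln (1 + \<epsilon>) / 3"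
  have \<eta>: "\<eta> > 0" using assms by (simp add: \<eta>_def)
  have "filterlim (\<lambda>n. 2 * \<eta> + ln (real n)) at_top sequentially"
    by (intro filterlim_tendsto_add_at_top[OF tendsto_const] filterlim_compose[OF ln_at_top] filterlim_real_sequentially)
  from eventually_compose_filterlim[OF eventually_prime_near_log[OF \<eta>] this]
  have "\<forall>\<^sub>F n in sequentially. \<exists>p. prime p \<and> \<bar>ln (real p) - (2 * \<eta> + ln (real n))\<bar> \<le> \<eta>" .
  then show ?thesis using eventually_gt_at_top[of 0]
  proof eventually_elim
    case (elim n)
    then obtain p where p: "prime p" "\<bar>ln (real p) - (2 * \<eta> + ln (real n))\<bar> \<le> \<eta>" by blast
    have p0: "p > 0" using p(1) by (simp add: prime_gt_0_nat)
    have 1: "ln (real n) + \<eta> \<le> ln (real p)" "ln (real p) \<le> ln (real n) + 3 * \<eta>" using p(2) by (simp_all add: abs_le_iff)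
    have "ln (real n) < ln (real p)" using 1 \<eta> by linarith
    then have "n < p" using elim p0 by simp
    have "ln (real p) \<le> ln ((1 + \<epsilon>) * real n)" using 1(2) assms elim by (simp add: \<eta>_def ln_mult)
    then have "real p \<le> (1 + \<epsilon>) * real n" using assms elim p0 by (subst (asm) ln_le_cancel_iff) auto
    with p(1) \<open>n < p\<close> show ?case by blast
  qed
qed

section \<open>The lower limit\<close>

lemma binomial_asymp: "(\<lambda>n. real (n choose h) / real n ^ h) \<longlonglongrightarrow> 1 / fact h"
proof -
  have "(\<lambda>n. (\<Prod>i = 0..<h. 1 - real i / real n) / fact h) \<longlonglongrightarrow> (\<Prod>i = 0..<h. 1 - 0) / fact h"
    by (intro tendsto_divide tendsto_prod tendsto_diff tendsto_const
         tendsto_divide_0[OF tendsto_const] filterlim_at_top_imp_at_infinity filterlim_real_sequentially) auto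
  moreover have "\<forall>\<^sub>F n in sequentially. (\<Prod>i = 0..<h. 1 - real i / real n) / fact h = real (n choose h) / real n ^ h"
    using eventually_gt_at_top[of 0]
  proof eventually_elim
    case (elim n)
    have "real (n choose h) = (\<Prod>i = 0..<h. real n - real i) / fact h"
      by (simp add: binomial_gbinomial gbinomial_prod_rev)
    also have "(\<Prod>i = 0..<h. real n - real i) = (\<Prod>i = 0..<h. real n * (1 - real i / real n))"
      using elim by (intro prod.cong) (auto simp: field_simps)
    also have "\<dots> = real n ^ h * (\<Prod>i = 0..<h. 1 - real i / real n)" by (simp add: prod.distrib)
    finally show ?case using elim by simp
  qed
  ultimately show ?thesis by (auto intro: Lim_transform_eventually)
qed

lemma code_A_ratio_ge:
  assumes p: "prime p" and n: "0 < n" "n < p" "real p \<le> (1 + \<epsilon>) * real n" and \<epsilon>: "\<epsilon> > 0"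
  shows "real (n choose h) / real n ^ h / ((real h + 1) * (1 + \<epsilon>) ^ h) \<le> real (code_A n (2 * h + 1)) / packing_B n h"
proof -
  let ?a = "real (code_A n (2 * h + 1))"
  have p0: "real p > 0" using n by simp
  have "real (2 ^ (n + 1)) \<le> real ((2 * h + 2) * p ^ h * code_A n (2 * h + 1))"
    using code_A_lower_bound[OF p n(2), of h] by (simp only: of_nat_le_iff)
  then have "2 ^ n \<le> (real h + 1) * real p ^ h * ?a" by (simp add: algebra_simps)
  also have "\<dots> \<le> (real h + 1) * ((1 + \<epsilon>) * real n) ^ h * ?a"
    using n by (intro mult_right_mono mult_left_mono power_mono) auto
  finally have a: "2 ^ n \<le> (real h + 1) * ((1 + \<epsilon>) * real n) ^ h * ?a" .
  have "real (n choose h) \<le> (\<Sum>i\<le>h. real (n choose i))"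
    by (rule member_le_sum) auto
  then have "2 ^ n * real (n choose h) \<le> ((real h + 1) * ((1 + \<epsilon>) * real n) ^ h * ?a) * (\<Sum>i\<le>h. real (n choose i))"
    using a \<epsilon> by (intro mult_mono mult_nonneg_nonneg zero_le_power) auto
  then have "real (n choose h) / ((real h + 1) * ((1 + \<epsilon>) * real n) ^ h) \<le> ?a * (\<Sum>i\<le>h. real (n choose i)) / 2 ^ n"
    using n \<epsilon> by (simp add: divide_simps mult_ac)
  then show ?thesis by (simp add: packing_B_def power_mult_distrib mult_ac)
qed

theorem theorem8:
  fixes h :: nat
  assumes "h > 0"
  shows "rho_inf h \<ge> ereal (1 / fact (h + 1))"
proof -
  \<comment> \<open>For fixed \<open>\<epsilon>\<close>, using a prime up to
    \<open>(1 + \<epsilon>) * n\<close> instead of \<open>n\<close> costs the factor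
    \<open>(1 + \<epsilon>) ^ h\<close>; the limit of \<open>(n choose h) / n ^ h\<close> supplies
    \<open>1 / fact h\<close>.\<close>
  have bound: "ereal (1 / fact h / ((real h + 1) * (1 + \<epsilon>) ^ h)) \<le> rho_inf h" if \<epsilon>: "\<epsilon> > 0" for \<epsilon> :: real
  proof -
    let ?b = "\<lambda>n. real (n choose h) / real n ^ h / ((real h + 1) * (1 + \<epsilon>) ^ h)"
    have "?b \<longlonglongrightarrow> 1 / fact h / ((real h + 1) * (1 + \<epsilon>) ^ h)"
      using \<epsilon> by (intro tendsto_divide binomial_asymp tendsto_const) auto
    then have "(\<lambda>n. ereal (?b n)) \<longlonglongrightarrow> ereal (1 / fact h / ((real h + 1) * (1 + \<epsilon>) ^ h))"
      by simp
    then have "ereal (1 / fact h / ((real h + 1) * (1 + \<epsilon>) ^ h)) = liminf (\<lambda>n. ereal (?b n))"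
      by (rule lim_imp_Liminf[OF sequentially_bot, symmetric])
    also have "\<dots> \<le> rho_inf h" unfolding rho_inf_def
    proof (rule Liminf_mono)
      show "\<forall>\<^sub>F n in sequentially. ereal (?b n) \<le> ereal (real (code_A n (2 * h + 1)) / packing_B n h)"
        using eventually_prime_between[OF \<epsilon>] eventually_gt_at_top[of 0]
      proof eventually_elim
        case (elim n)
        then show ?case using code_A_ratio_ge[OF _ _ _ _ \<epsilon>] by auto
      qed
    qed
    finally show ?thesis .
  qed
  \<comment> \<open>The left side of \<open>bound\<close> is the only one depending on
    \<open>\<epsilon>\<close>, so it may tend to 0; then
    \<open>fact h * (h + 1) = fact (h + 1)\<close>.\<close>
  have "((\<lambda>\<epsilon>. 1 / fact h / ((real h + 1) * (1 + \<epsilon>) ^ h)) \<longlongrightarrow> 1 / fact h / ((real h + 1) * (1 + 0) ^ h)) (at_right 0)"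
    by (intro tendsto_intros) auto
  also have "1 / fact h / ((real h + 1) * (1 + 0) ^ h) = (1 / fact (h + 1) :: real)"
    by (simp add: add.commute)
  finally have "((\<lambda>\<epsilon>. ereal (1 / fact h / ((real h + 1) * (1 + \<epsilon>) ^ h))) \<longlongrightarrow> ereal (1 / fact (h + 1))) (at_right 0)"
    by simp
  then show ?thesis
    by (rule tendsto_upperbound)
      (use bound in \<open>auto intro!: eventually_mono[OF eventually_at_right_less[of 0]]\<close>)
qed

end
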